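(* Let $\varepsilon\in(0,1/8)$ be given. For positive integers $n,N,M$ let $p_n(N,M)$ denote the number of partitions of $n$ with every part at most $N$ and with at most $M$ parts, and set $\alpha=N/\sqrt{n}$, $\beta=M/\sqrt{n}$. Let $g(\alpha,\beta)>0$ be the unique positive solution of $$g^2(\alpha,\beta)=\mathrm{Li}_2\big(1-e^{-\alpha g(\alpha,\beta)}\big)+\mathrm{Li}_2\big(1-e^{-\beta g(\alpha,\beta)}\big)-\mathrm{Li}_2\big(1-e^{-(\alpha+\beta)g(\alpha,\beta)}\big),$$ and define $$L(\alpha,\beta)=2g^2(\alpha,\beta)+\frac{(\alpha+\beta)^2g^2(\alpha,\beta)}{e^{(\alpha+\beta)g(\alpha,\beta)}-1}-\frac{\alpha^2g^2(\alpha,\beta)}{e^{\alpha g(\alpha,\beta)}-1}-\frac{\beta^2g^2(\alpha,\beta)}{e^{\beta g(\alpha,\beta)}-1},$$ $$K(\alpha,\beta)=g(\alpha,\beta)+\frac{1}{g(\alpha,\beta)}\Big(\frac{\pi^2}{6}+\mathrm{Li}_2\big(e^{-(\alpha+\beta)g(\alpha,\beta)}\big)-\mathrm{Li}_2\big(e^{-\alpha g(\alpha,\beta)}\big)-\mathrm{Li}_2\big(e^{-\beta g(\alpha,\beta)}\big)\Big).$$ Then, uniformly for $N\ge 4\sqrt{n}$ and $M\ge 4\sqrt n$, as $n\to\infty$, $$p_n(N,M)=\frac{g(\alpha,\beta)^2}{2\pi\sqrt{L(\alpha,\beta)}}\sqrt{\frac{1-e^{-(\alpha+\beta)g(\alpha,\beta)}}{(1-e^{-\alpha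 g(\alpha,\beta)})(1-e^{-\beta g(\alpha,\beta)})}}\cdot\frac{e^{\sqrt n K(\alpha,\beta)}}{n}\Big(1+O(n^{-1/4+\varepsilon})\Big).$$
   Context: $\mathrm{Li}_2$ denotes the dilogarithm (Spence's function), $\mathrm{Li}_2(z)=\sum_{k\ge1}z^k/k^2$ for $|z|\le 1$, equivalently $\mathrm{Li}_2(z)=-\int_0^z\frac{\log(1-u)}{u}\,du$. The implied constant in the $O(\cdot)$ term is uniform over $\alpha,\beta\ge 4$. *)

theory Defs
  imports "HOL-Analysis.Analysis" "HOL-Library.Multiset"
begin

(* The series converges exactly for norm z <= 1; dilog is only meaningful there. *)
definition dilog :: "'a::{real_normed_field,banach} \<Rightarrow> 'a" where
  "dilog z = (\<Sum>k. z ^ Suc k / of_nat (Suc k) ^ 2)"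

definition bounded_partitions :: "nat \<Rightarrow> nat \<Rightarrow> nat \<Rightarrow> nat multiset set" where
  "bounded_partitions n N M =
     {P. sum_mset P = n \<and> (\<forall>x\<in>#P. 1 \<le> x \<and> x \<le> N) \<and> size P \<le> M}"

definition partition_count :: "nat \<Rightarrow> nat \<Rightarrow> nat \<Rightarrow> nat" where
  "partition_count n N M = card (bounded_partitions n N M)"

definition is_saddle :: "real \<Rightarrow> real \<Rightarrow> real \<Rightarrow> bool" where
  "is_saddle \<alpha> \<beta> g \<longleftrightarrow> g > 0 \<and>
     g\<^sup>2 = dilog (1 - exp (- (\<alpha> * g))) + dilog (1 - exp (- (\<beta> * g)))
           - dilog (1 - exp (- ((\<alpha> + \<beta>) * g)))"

definition saddle :: "real \<Rightarrow> real \<Rightarrow> real" where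
  "saddle \<alpha> \<beta> = (THE g. is_saddle \<alpha> \<beta> g)"

definition L_fun :: "real \<Rightarrow> real \<Rightarrow> real" where
  "L_fun \<alpha> \<beta> = (let g = saddle \<alpha> \<beta> in
     2 * g\<^sup>2 + (\<alpha> + \<beta>)\<^sup>2 * g\<^sup>2 / (exp ((\<alpha> + \<beta>) * g) - 1)
     - \<alpha>\<^sup>2 * g\<^sup>2 / (exp (\<alpha> * g) - 1) - \<beta>\<^sup>2 * g\<^sup>2 / (exp (\<beta> * g) - 1))"

definition K_fun :: "real \<Rightarrow> real \<Rightarrow> real" where
  "K_fun \<alpha> \<beta> = (let g = saddle \<alpha> \<beta> in
     g + 1 / g * (pi\<^sup>2 / 6 + dilog (exp (- ((\<alpha> + \<beta>) * g)))
                  - dilog (exp (- (\<alpha> * g))) - dilog (exp (- (\<beta> * g)))))"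

definition main_term :: "nat \<Rightarrow> nat \<Rightarrow> nat \<Rightarrow> real" where
  "main_term n N M =
     (let \<alpha> = real N / sqrt (real n); \<beta> = real M / sqrt (real n); g = saddle \<alpha> \<beta> in
        g\<^sup>2 / (2 * pi * sqrt (L_fun \<alpha> \<beta>))
        * sqrt ((1 - exp (- ((\<alpha> + \<beta>) * g))) / ((1 - exp (- (\<alpha> * g))) * (1 - exp (- (\<beta> * g)))))
        * (exp (sqrt (real n) * K_fun \<alpha> \<beta>) / real n))"

end

theory Submission
  imports Defs "HOL-Probability.Distributions"
begin

text \<open>
  The generating function of the partitions in an \<open>N \<times> M\<close> box is the Gaussian binomial coefficient, so
  Cauchy's formula on the circle of radius \<open>exp (- v)\<close>, \<open>v = g / sqrt n\<close>, writes the count as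
  \<open>exp (n * v)\<close> times a Fourier coefficient of a quotient of products of factors
  \<open>1 - exp (- v * j) * cis (j * t)\<close>. The saddle equation says that the associated random variable has mean
  \<open>n + O (1 / v)\<close>; its variance is \<open>L / v ^ 3 + O (1 / v\<^sup>2)\<close>, and the third-order term of the logarithm of its
  characteristic function is \<open>O (\<bar>t\<bar> ^ 3 / v ^ 4)\<close>. Since \<open>\<bar>exp a - exp b\<bar> \<le> \<bar>a - b\<bar> * max \<bar>exp a\<bar> \<bar>exp b\<bar>\<close>, a decay bound for the
  characteristic function on the whole circle turns this Taylor expansion into a comparison of
  integrals with relative error \<open>O (sqrt v)\<close>. The hypothesis \<open>\<alpha>, \<beta> \<ge> 4\<close> makes the factors in the
  numerator of the Gaussian binomial too small to destroy the decay coming from its denominator. The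
  value at \<open>t = 0\<close> is obtained by a trapezoidal comparison with Stirling's formula.
\<close>

section \<open>The dilogarithm\<close>

text \<open>Only \<open>v\<close>, of order n^(-1/2), is small, while \<open>\<alpha>\<close> and
  \<open>\<beta>\<close> may be arbitrarily large. Uniformity therefore rests on estimates that do
  not see the number of factors: Riemann sums of decreasing functions, whose error is at most one
  step times the value at 0, and trapezoidal errors that telescope. The natural width of the
  integrand is |t| ~ v^(3/2). There the remainders |t| / v, t^2 / v^2 and |t|^3 / v^4 have sizes
  v^(1/2), v and v^(1/2), which explains the relative error sqrt v. No division into major and minor
  arcs is made: the decay bound is the sum of a Gaussian in t / v^(3/2) and the constant exp (-1 /
  (5 v)), and both are multiplied by the same polynomial remainder. The delicate point is numerical.
  The saddle lies between 1 and 2, so \<open>v * N\<close> and \<open>v * M\<close> are at least 4,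
  and exp 4 > 50 is the number from which both the location of the saddle and the margin in the
  decay are drawn.\<close>

lemma summable_dilog:
  fixes z :: real
  assumes "\<bar>z\<bar> \<le> 1"
  shows "summable (\<lambda>k. z ^ Suc k / of_nat (Suc k) ^ 2)"
proof (rule summable_comparison_test[OF _ sums_summable[OF inverse_squares_sums]], intro exI allI impI)
  fix k :: nat
  have "\<bar>z ^ Suc k\<bar> \<le> 1"
    using assms power_le_one[of "\<bar>z\<bar>" "Suc k"] by (simp add: power_abs del: power_Suc)
  then show "norm (z ^ Suc k / of_nat (Suc k) ^ 2) \<le> 1 / (k + 1)\<^sup>2"
    by (simp add: divide_right_mono add.commute del: power_Suc)
qed

lemma dilog_one: "dilog (1::real) = pi\<^sup>2 / 6"
  using inverse_squares_sums by (simp add: dilog_def sums_iff add.commute)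

lemma dilog_zero: "dilog (0::real) = 0"
  by (simp add: dilog_def)

text \<open>The M-test covers the closed interval. The endpoint 1 matters:
  \<open>dilog (exp (- x))\<close> starts there at x = 0, where its derivative ln (1 - exp (- x)) is
  unbounded.\<close>

lemma continuous_on_dilog: "continuous_on {-1..1::real} dilog"
proof -
  have "uniform_limit {-1..1::real} (\<lambda>n z. \<Sum>k<n. z ^ Suc k / of_nat (Suc k) ^ 2) dilog sequentially"
    unfolding dilog_def[abs_def]
  proof (rule Weierstrass_m_test)
    show "summable (\<lambda>n. 1 / (real n + 1)\<^sup>2)"
      using inverse_squares_sums by (simp add: sums_iff add.commute)
    fix n :: nat and x :: real assume "x \<in> {-1..1}"
    then have "\<bar>x\<bar> \<le> 1" by auto
    then have "\<bar>x ^ Suc n\<bar> \<le> 1"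
      using power_le_one[of "\<bar>x\<bar>" "Suc n"] by (simp add: power_abs del: power_Suc)
    then show "norm (x ^ Suc n / (of_nat (Suc n))\<^sup>2) \<le> 1 / (real n + 1)\<^sup>2"
      by (simp add: divide_right_mono add.commute del: power_Suc)
  qed
  then show ?thesis
    by (rule uniform_limit_theorem[rotated]) (auto intro!: continuous_intros always_eventually)
qed

lemma dilog_mono:
  fixes x y :: real
  assumes "0 \<le> x" "x \<le> y" "y \<le> 1"
  shows "dilog x \<le> dilog y"
  unfolding dilog_def
proof (rule suminf_le)
  show "summable (\<lambda>k. x ^ Suc k / (of_nat (Suc k))\<^sup>2)" "summable (\<lambda>k. y ^ Suc k / (of_nat (Suc k))\<^sup>2)"
    using assms by (intro summable_dilog; simp)+
  show "x ^ Suc k / (of_nat (Suc k))\<^sup>2 \<le> y ^ Suc k / (of_nat (Suc k))\<^sup>2" for k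
    using assms by (intro divide_right_mono power_mono) auto
qed

lemma dilog_le: "dilog x \<le> pi\<^sup>2 / 6" if "0 \<le> x" "x \<le> 1" for x :: real
  using dilog_mono[of x 1] that by (simp add: dilog_one)

text \<open>Termwise differentiation gives the sum of z^n / (n + 1), the logarithmic series divided
  by z. The point 0 is excluded because the closed form reads 0 / 0 = 0 there, while the derivative
  is 1.\<close>

lemma DERIV_dilog:
  fixes z :: real
  assumes "\<bar>z\<bar> < 1" "z \<noteq> 0"
  shows "(dilog has_real_derivative (- ln (1 - z) / z)) (at z)"
proof -
  \<comment> \<open>\<open>c 0\<close> is 1 / 0 = 0, so the shifted series becomes an ordinary power
    series with vanishing constant term.\<close>
  define c where "c k = 1 / (real k)\<^sup>2" for k
  have sm: "summable (\<lambda>k. c k * x ^ k)" if "\<bar>x\<bar> \<le> 1" for x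
    using summable_dilog[OF that] summable_Suc_iff[of "\<lambda>k. c k * x ^ k"]
    by (simp add: c_def)
  have eq: "dilog x = (\<Sum>k. c k * x ^ k)" if "\<bar>x\<bar> \<le> 1" for x
    using suminf_split_head[OF sm[OF that]] by (simp add: c_def dilog_def)
  have "((\<lambda>x. \<Sum>k. c k * x ^ k) has_real_derivative (\<Sum>k. diffs c k * z ^ k)) (at z)"
    by (rule termdiffs_strong[of c 1]) (use sm[of 1] assms in auto)
  moreover have "(\<Sum>k. diffs c k * z ^ k) = - ln (1 - z) / z"
  proof -
    have "(\<lambda>n. - (z ^ n) / real n) sums ln (1 - z)"
      using ln_series'[of "-z"] assms by simp
    then have "(\<lambda>n. - (z ^ Suc n) / real (Suc n)) sums ln (1 - z)"
      by (subst sums_Suc_iff) simp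
    from sums_divide[OF sums_minus[OF this], of z]
    have "(\<lambda>n. z ^ n / real (Suc n)) sums (- ln (1 - z) / z)"
      using assms(2) by simp
    moreover have "diffs c n = 1 / real (Suc n)" for n
      by (simp add: diffs_def c_def power2_eq_square del: of_nat_Suc)
    ultimately have "(\<lambda>n. diffs c n * z ^ n) sums (- ln (1 - z) / z)"
      by simp
    then show ?thesis by (simp add: sums_iff)
  qed
  moreover have "eventually (\<lambda>x. (\<Sum>k. c k * x ^ k) = dilog x) (nhds z)"
  proof (rule eventually_nhds_in_open[of "{-1<..<1}", THEN eventually_mono])
    fix x :: real assume "x \<in> {-1<..<1}"
    then show "(\<Sum>k. c k * x ^ k) = dilog x" by (subst eq) auto
  qed (use assms in auto)
  ultimately show ?thesis
    using DERIV_cong_ev[of z z "\<lambda>x. \<Sum>k. c k * x ^ k" dilog "- ln (1 - z) / z" "- ln (1 - z) / z"] by simp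
qed

lemma DERIV_dilog_one_minus_exp:
  fixes x :: real
  assumes "0 < x"
  shows "((\<lambda>x. dilog (1 - exp (- x))) has_real_derivative x / (exp x - 1)) (at x)"
proof -
  have "((\<lambda>x. dilog (1 - exp (- x))) has_real_derivative
      (- ln (1 - (1 - exp (- x))) / (1 - exp (- x))) * exp (- x)) (at x)"
    by (rule DERIV_chain2[OF DERIV_dilog]) (use assms in \<open>auto intro!: derivative_eq_intros\<close>)
  moreover have "(- ln (1 - (1 - exp (- x))) / (1 - exp (- x))) * exp (- x) = x / (exp x - 1)"
  proof -
    have "exp x - 1 \<noteq> 0" "exp x \<noteq> 0" using assms by auto
    moreover have "ln (1 - (1 - exp (- x))) = - x" by simp
    ultimately show ?thesis unfolding exp_minus by (simp add: field_simps)
  qed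
  ultimately show ?thesis by simp
qed

lemma DERIV_dilog_exp:
  fixes x :: real
  assumes "0 < x"
  shows "((\<lambda>x. dilog (exp (- x))) has_real_derivative ln (1 - exp (- x))) (at x)"
proof -
  have "((\<lambda>x. dilog (exp (- x))) has_real_derivative
      (- ln (1 - exp (- x)) / exp (- x)) * (- exp (- x))) (at x)"
    by (rule DERIV_chain2[OF DERIV_dilog]) (use assms in \<open>auto intro!: derivative_eq_intros\<close>)
  then show ?thesis by simp
qed

lemma continuous_on_dilog_one_minus_exp:
  "continuous_on {0::real..} (\<lambda>x. dilog (1 - exp (- x)))"
proof (rule continuous_on_compose2[OF continuous_on_dilog])
  have "exp (-x) \<le> 2" if "0 \<le> x" for x :: real
    using that exp_le_one_iff[of "-x"] by linarith
  then show "(\<lambda>x::real. 1 - exp (- x)) ` {0..} \<subseteq> {- 1..1}" by auto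
qed (auto intro!: continuous_intros)

lemma continuous_on_dilog_exp:
  "continuous_on {0::real..} (\<lambda>x. dilog (exp (- x)))"
proof (rule continuous_on_compose2[OF continuous_on_dilog])
  have "-1 \<le> exp (-x)" for x :: real
    using exp_gt_zero[of "-x"] by linarith
  then show "(\<lambda>x::real. exp (- x)) ` {0..} \<subseteq> {- 1..1}" by auto
qed (auto intro!: continuous_intros)

section \<open>The saddle point\<close>

lemma sinh_ge_self:
  fixes y :: real
  assumes "0 \<le> y"
  shows "y \<le> sinh y"
proof -
  have "sinh 0 - 0 \<le> sinh y - y"
  proof (rule DERIV_nonneg_imp_nondecreasing[OF assms])
    fix x :: real
    have "((\<lambda>y. sinh y - y) has_real_derivative cosh x - 1) (at x)"
      by (auto intro!: derivative_eq_intros)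
    then show "\<exists>d. ((\<lambda>y. sinh y - y) has_real_derivative d) (at x) \<and> d \<ge> 0"
      using cosh_real_ge_1[of x] by (intro exI[of _ "cosh x - 1"]) simp
  qed
  then show ?thesis by simp
qed

lemma sinh_less_mult_cosh:
  fixes y :: real
  assumes "0 < y"
  shows "sinh y < y * cosh y"
proof -
  have "0 * cosh 0 - sinh 0 < y * cosh y - sinh y"
  proof (rule DERIV_pos_imp_increasing_open[OF assms])
    fix x :: real assume x: "0 < x"
    have "((\<lambda>y. y * cosh y - sinh y) has_real_derivative x * sinh x) (at x)"
      by (auto intro!: derivative_eq_intros)
    with x show "\<exists>d. ((\<lambda>y. y * cosh y - sinh y) has_real_derivative d) (at x) \<and> d > 0"
      by (intro exI[of _ "x * sinh x"]) auto
  qed (auto intro!: continuous_intros)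
  then show ?thesis by simp
qed

lemma divide_sinh_strict_antimono:
  fixes x y :: real
  assumes "0 < x" "x < y"
  shows "y / sinh y < x / sinh x"
proof (rule DERIV_neg_imp_decreasing[OF assms(2)])
  fix t :: real assume t: "x \<le> t" "t \<le> y"
  then have pos: "0 < t" using assms by simp
  have "((\<lambda>t. t / sinh t) has_real_derivative (sinh t - t * cosh t) / (sinh t)\<^sup>2) (at t)"
    using pos by (auto intro!: derivative_eq_intros simp: power2_eq_square)
  moreover have "(sinh t - t * cosh t) / (sinh t)\<^sup>2 < 0"
    using sinh_less_mult_cosh[OF pos] pos by (intro divide_neg_pos) auto
  ultimately show "\<exists>d. ((\<lambda>t. t / sinh t) has_real_derivative d) (at t) \<and> d < 0" by blast
qed

text \<open>The values at \<open>0\<close> are the limits; the formulas themselves would give \<open>0 / 0 = 0\<close> there.\<close>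

definition bose :: "real \<Rightarrow> real" where
  "bose x = (if x = 0 then 1 else x / (exp x - 1))"

definition bose2 :: "real \<Rightarrow> real" where
  "bose2 x = (if x = 0 then 1 else x\<^sup>2 * exp x / (exp x - 1)\<^sup>2)"

text \<open>The integral of u / (exp u - 1) over [0, x], a Debye function; the saddle equation
  combines three of its values.\<close>

definition debye :: "real \<Rightarrow> real" where
  "debye x = dilog (1 - exp (- x))"

text \<open>The antiderivative of \<open>bose2\<close> vanishing at 0, found by integration by
  parts. It describes variances as \<open>debye\<close> describes means.\<close>

definition debye2 :: "real \<Rightarrow> real" where
  "debye2 x = 2 * debye x - x\<^sup>2 / (exp x - 1)"

lemma debye_0 [simp]: "debye 0 = 0" and debye2_0 [simp]: "debye2 0 = 0"
  by (simp_all add: debye_def debye2_def dilog_zero)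

lemma exp_minus_one_eq_sinh: "exp x - 1 = 2 * exp (x/2) * sinh (x/2)" for x :: real
proof -
  have "exp x = exp (x/2) * exp (x/2)" by (simp flip: exp_add)
  then show ?thesis by (simp add: sinh_def exp_minus field_simps)
qed

text \<open>Symmetrising the exponentials reduces the monotonicity of \<open>bose2\<close> to that
  of y / sinh y.\<close>

lemma bose2_eq_sinh:
  assumes "0 < x"
  shows "bose2 x = ((x/2) / sinh (x/2))\<^sup>2"
proof -
  have "exp x = exp (x/2) * exp (x/2)" by (simp flip: exp_add)
  then show ?thesis
    using assms unfolding bose2_def exp_minus_one_eq_sinh
    by (simp add: power2_eq_square)
qed

lemma bose2_strict_antimono:
  assumes "0 < x" "x < y"
  shows "bose2 y < bose2 x"
proof -
  have "(y/2) / sinh (y/2) < (x/2) / sinh (x/2)"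
    using assms by (intro divide_sinh_strict_antimono) auto
  moreover have "0 \<le> (y/2) / sinh (y/2)"
    using assms by auto
  ultimately show ?thesis
    using assms by (simp only: bose2_eq_sinh) (auto simp: power_strict_mono)
qed

lemma bose2_antimono:
  assumes "0 \<le> x" "x \<le> y"
  shows "bose2 y \<le> bose2 x"
proof (cases "x = 0 \<and> y > 0")
  case True
  then have "(y/2) / sinh (y/2) \<le> 1"
    using sinh_ge_self[of "y/2"] by (simp add: divide_le_eq_1)
  then have "((y/2) / sinh (y/2))\<^sup>2 \<le> 1"
    using True by (intro power_le_one) auto
  then show ?thesis using True by (simp add: bose2_eq_sinh) (simp add: bose2_def)
next
  case False
  then show ?thesis using assms bose2_strict_antimono[of x y] by (cases "x = y") auto
qed

lemma bose_antimono:
  assumes "0 \<le> x" "x \<le> y"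
  shows "bose y \<le> bose x"
proof (cases "x = 0")
  case True
  then show ?thesis
    using assms exp_ge_add_one_self[of y] by (auto simp: bose_def divide_le_eq_1 algebra_simps)
next
  case False
  have "y / (exp y - 1) \<le> x / (exp x - 1)"
  proof (rule DERIV_nonpos_imp_nonincreasing[OF assms(2)])
    fix t :: real assume "x \<le> t" "t \<le> y"
    then have t: "0 < t" using assms False by simp
    have "((\<lambda>t. t / (exp t - 1)) has_real_derivative (exp t - 1 - t * exp t) / (exp t - 1)\<^sup>2) (at t)"
      using t by (auto intro!: derivative_eq_intros simp: power2_eq_square)
    moreover have "exp t - 1 - t * exp t \<le> 0"
    proof -
      have "(1 - t) * exp t \<le> exp (- t) * exp t"
        using exp_ge_add_one_self[of "-t"] by (intro mult_right_mono) auto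
      then show ?thesis by (simp add: algebra_simps flip: exp_add)
    qed
    ultimately show "\<exists>d. ((\<lambda>t. t / (exp t - 1)) has_real_derivative d) (at t) \<and> d \<le> 0"
      by (intro exI conjI) (auto intro!: divide_nonpos_nonneg)
  qed
  then show ?thesis using False assms by (simp add: bose_def)
qed

lemma bose_nonneg: "0 \<le> x \<Longrightarrow> 0 \<le> bose x"
  and bose2_nonneg: "0 \<le> bose2 x"
  by (simp_all add: bose_def bose2_def)

lemma DERIV_debye: "0 < x \<Longrightarrow> (debye has_real_derivative bose x) (at x)"
  using DERIV_dilog_one_minus_exp[of x] by (simp add: debye_def[abs_def] bose_def)

lemma DERIV_debye2:
  assumes "0 < x"
  shows "(debye2 has_real_derivative bose2 x) (at x)"
proof -
  have nz: "exp x - 1 \<noteq> 0" using assms by simp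
  have "(debye2 has_real_derivative
      2 * bose x - (2 * x * (exp x - 1) - x\<^sup>2 * exp x) / (exp x - 1)\<^sup>2) (at x)"
    unfolding debye2_def[abs_def]
    using nz by (auto intro!: derivative_eq_intros DERIV_debye assms simp: power2_eq_square)
  moreover have "2 * bose x - (2 * x * (exp x - 1) - x\<^sup>2 * exp x) / (exp x - 1)\<^sup>2 = bose2 x"
    using nz assms by (simp add: bose_def bose2_def divide_simps power2_eq_square)
  ultimately show ?thesis by simp
qed

lemma continuous_on_debye: "continuous_on {0..} debye"
  using continuous_on_dilog_one_minus_exp by (simp add: debye_def[abs_def])

lemma square_div_exp_minus_one_bounds:
  fixes x :: real
  assumes "0 \<le> x"
  shows "0 \<le> x\<^sup>2 / (exp x - 1)" "x\<^sup>2 / (exp x - 1) \<le> x"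
proof -
  show "0 \<le> x\<^sup>2 / (exp x - 1)" using assms by simp
  have "x * bose x \<le> x * bose 0"
    using bose_antimono[of 0 x] assms by (intro mult_left_mono) auto
  then show "x\<^sup>2 / (exp x - 1) \<le> x"
    using assms by (cases "x = 0") (simp_all add: bose_def power2_eq_square)
qed

text \<open>At 0 the quotient x^2 / (exp x - 1) takes the default value 0, which is also its limit,
  since it lies between 0 and x.\<close>

lemma continuous_on_debye2: "continuous_on {0..} debye2"
proof -
  have "continuous_on {0..} (\<lambda>x::real. x\<^sup>2 / (exp x - 1))"
    unfolding continuous_on_eq_continuous_within
  proof
    fix x :: real assume "x \<in> {0..}"
    then consider "x = 0" | "x > 0" by fastforce
    then show "continuous (at x within {0..}) (\<lambda>x. x\<^sup>2 / (exp x - 1))"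
    proof cases
      case 1
      have "((\<lambda>x::real. x\<^sup>2 / (exp x - 1)) \<longlongrightarrow> 0) (at 0 within {0..})"
      proof (rule tendsto_sandwich)
        show "((\<lambda>x::real. 0) \<longlongrightarrow> 0) (at 0 within {0..})" "((\<lambda>x::real. x) \<longlongrightarrow> 0) (at 0 within {0..})"
          by (auto intro!: tendsto_intros)
      qed (auto simp: eventually_at square_div_exp_minus_one_bounds intro!: exI[of _ 1])
      with 1 show ?thesis by (simp add: continuous_within)
    qed (auto intro!: continuous_intros)
  qed
  then show ?thesis
    unfolding debye2_def[abs_def]
    by (intro continuous_on_diff continuous_on_mult continuous_on_const continuous_on_debye)
qed

text \<open>The derivative \<open>bose2\<close> is strictly decreasing, so \<open>debye2\<close> is
  strictly concave; together with the value 0 at 0 this gives strict subadditivity.\<close>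

lemma debye2_subadditive:
  assumes "0 < x" "0 < y"
  shows "debye2 (x + y) < debye2 x + debye2 y"
proof -
  have "debye2 0 - debye2 (x + 0) < debye2 y - debye2 (x + y)"
  proof (rule DERIV_pos_imp_increasing_open[OF assms(2)])
    fix t :: real assume t: "0 < t"
    have "((\<lambda>t. debye2 t - debye2 (x + t)) has_real_derivative bose2 t - bose2 (x + t)) (at t)"
      by (rule DERIV_diff DERIV_debye2 DERIV_chain2[where f = debye2, of _ _ _ 1, simplified]
          | use t assms in \<open>auto intro!: derivative_eq_intros\<close>)+
    moreover have "bose2 (x + t) < bose2 t"
      using t assms by (intro bose2_strict_antimono) auto
    ultimately show "\<exists>d. ((\<lambda>t. debye2 t - debye2 (x + t)) has_real_derivative d) (at t) \<and> d > 0"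
      by (intro exI conjI) auto
  next
    show "continuous_on {0..y} (\<lambda>t. debye2 t - debye2 (x + t))"
      using assms
      by (intro continuous_intros continuous_on_compose2[OF continuous_on_debye2])
        (auto intro!: continuous_intros)
  qed
  then show ?thesis by simp
qed

lemma debye_mono:
  assumes "0 \<le> x" "x \<le> y"
  shows "debye x \<le> debye y"
  unfolding debye_def using assms by (intro dilog_mono) auto

section \<open>Numerical bounds and the unique saddle point\<close>

lemma pi_less_3_2: "pi < 16/5"
  using pi_approx by (simp add: abs_le_iff)

text \<open>The supremum is pi^2 / 6, and 1.71 lies just above (16/5)^2 / 6 = 1.7066...\<close>

lemma debye_le:
  assumes "0 \<le> x"
  shows "debye x < 1.71"
proof -
  have "debye x \<le> pi\<^sup>2 / 6" using assms unfolding debye_def by (intro dilog_le) auto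
  also have "pi\<^sup>2 < (16/5)\<^sup>2"
    using pi_less_3_2 by (intro power_strict_mono) auto
  then have "pi\<^sup>2 / 6 < 1.71" by (simp add: power2_eq_square)
  finally show ?thesis .
qed

text \<open>Eight terms of the series already give about 51.8.\<close>

lemma exp_4_gt: "exp (4::real) > 50"
proof -
  have "(\<Sum>k<8. (4::real) ^ k /\<^sub>R fact k) \<le> exp 4"
    unfolding exp_def by (rule sum_le_suminf[OF summable_exp_generic]) auto
  then show ?thesis by (simp add: lessThan_nat_numeral fact_numeral)
qed

text \<open>From exp (- 4) < 1/50 the argument of \<open>dilog\<close> is at least 49/50, where four
  terms of the series sum to about 1.382. The value is chosen so that 2 * 1.38 - 1.71 > 1.\<close>

lemma debye_ge: 
  assumes "4 \<le> x"
  shows "1.38 < debye x"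
proof -
  have "50 * exp (- x) \<le> exp 4 * exp (- x)"
    using exp_4_gt by (intro mult_right_mono) auto
  also have "\<dots> = exp (4 - x)" by (simp flip: exp_add)
  also have "\<dots> \<le> 1" using assms by simp
  finally have "exp (- x) \<le> 1/50" by simp
  then have "dilog (49/50) \<le> debye x"
    unfolding debye_def by (intro dilog_mono) auto
  moreover have "(\<Sum>k<4. (49/50::real) ^ Suc k / of_nat (Suc k) ^ 2) \<le> dilog (49/50)"
    unfolding dilog_def by (rule sum_le_suminf[OF summable_dilog]) auto
  ultimately show ?thesis
    by (simp add: lessThan_nat_numeral power2_eq_square eval_nat_numeral)
qed

text \<open>The derivative of the quotient of the right-hand side of the saddle equation by \<open>g\<^sup>2\<close> has the sign of
  \<open>debye2 ((\<alpha> + \<beta>) * g) - debye2 (\<alpha> * g) - debye2 (\<beta> * g)\<close>, which is negative by subadditivity.\<close>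

definition saddle_rhs :: "real \<Rightarrow> real \<Rightarrow> real \<Rightarrow> real" where
  "saddle_rhs \<alpha> \<beta> g = debye (\<alpha> * g) + debye (\<beta> * g) - debye ((\<alpha> + \<beta>) * g)"

lemma is_saddle_iff: "is_saddle \<alpha> \<beta> g \<longleftrightarrow> g > 0 \<and> g\<^sup>2 = saddle_rhs \<alpha> \<beta> g"
  by (simp add: is_saddle_def saddle_rhs_def debye_def)

lemma saddle_rhs_quotient_strict_antimono:
  assumes "0 < \<alpha>" "0 < \<beta>" "0 < g" "g < h"
  shows "saddle_rhs \<alpha> \<beta> h / h\<^sup>2 < saddle_rhs \<alpha> \<beta> g / g\<^sup>2"
proof (rule DERIV_neg_imp_decreasing[OF assms(4)])
  fix t :: real assume "g \<le> t" "t \<le> h"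
  then have t: "0 < t" using assms by simp
  have debye_lin: "((\<lambda>t. debye (c * t)) has_real_derivative bose (c * t) * c) (at t)" if "0 < c" for c
    by (rule DERIV_chain2[OF DERIV_debye]) (use that t in \<open>auto intro!: derivative_eq_intros\<close>)
  define d where "d = bose (\<alpha> * t) * \<alpha> + bose (\<beta> * t) * \<beta> - bose ((\<alpha> + \<beta>) * t) * (\<alpha> + \<beta>)"
  have "(saddle_rhs \<alpha> \<beta> has_real_derivative d) (at t)"
    unfolding saddle_rhs_def[abs_def] d_def
    using assms by (intro DERIV_add DERIV_diff debye_lin) auto
  then have D: "((\<lambda>t. saddle_rhs \<alpha> \<beta> t / t\<^sup>2) has_real_derivative
      (d * t\<^sup>2 - saddle_rhs \<alpha> \<beta> t * (2 * t)) / (t\<^sup>2 * t\<^sup>2)) (at t)"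
    using t by (auto intro!: derivative_eq_intros)
  have bt: "bose (c * t) * c * t = (c * t)\<^sup>2 / (exp (c * t) - 1)" if "0 < c" for c
    using that t by (simp add: bose_def power2_eq_square)
  have "d * t - 2 * saddle_rhs \<alpha> \<beta> t =
      - (debye2 (\<alpha> * t) + debye2 (\<beta> * t) - debye2 ((\<alpha> + \<beta>) * t))"
  proof -
    have "d * t = bose (\<alpha> * t) * \<alpha> * t + bose (\<beta> * t) * \<beta> * t - bose ((\<alpha> + \<beta>) * t) * (\<alpha> + \<beta>) * t"
      by (simp only: d_def left_diff_distrib distrib_right)
    then show ?thesis
      using assms by (simp add: bt saddle_rhs_def debye2_def)
  qed
  also have "\<dots> < 0"
    using debye2_subadditive[of "\<alpha> * t" "\<beta> * t"] assms t by (simp add: distrib_right)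
  finally have "t * (d * t - 2 * saddle_rhs \<alpha> \<beta> t) < 0"
    using t by (simp add: mult_pos_neg)
  then have "d * t\<^sup>2 - saddle_rhs \<alpha> \<beta> t * (2 * t) < 0"
    by (simp add: power2_eq_square algebra_simps)
  then have "(d * t\<^sup>2 - saddle_rhs \<alpha> \<beta> t * (2 * t)) / (t\<^sup>2 * t\<^sup>2) < 0"
    using t by (intro divide_neg_pos) auto
  with D show "\<exists>d. ((\<lambda>t. saddle_rhs \<alpha> \<beta> t / t\<^sup>2) has_real_derivative d) (at t) \<and> d < 0"
    by blast
qed

lemma saddle_rhs_1:
  assumes "4 \<le> \<alpha>" "4 \<le> \<beta>"
  shows "1 < saddle_rhs \<alpha> \<beta> 1"
  using debye_ge[OF assms(1)] debye_ge[OF assms(2)] debye_le[of "\<alpha> + \<beta>"] assms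
  by (simp add: saddle_rhs_def)

lemma saddle_rhs_less:
  assumes "0 \<le> \<alpha>" "0 \<le> \<beta>" "0 \<le> g"
  shows "saddle_rhs \<alpha> \<beta> g < 1.71"
proof -
  have "debye (\<beta> * g) \<le> debye ((\<alpha> + \<beta>) * g)"
    using assms by (intro debye_mono) (auto intro: mult_right_mono)
  moreover have "debye (\<alpha> * g) < 1.71"
    using assms by (intro debye_le) auto
  ultimately show ?thesis by (simp add: saddle_rhs_def)
qed

text \<open>At a saddle the quotient of \<open>saddle_rhs\<close> by g^2 equals 1. This quotient
  decreases and exceeds 1 at g = 1, so g > 1; and g < 2 because \<open>saddle_rhs\<close> stays
  below 1.71 < 4. The lower bound later turns \<alpha>, \<beta> >= 4 into \<open>v * N\<close>,
  \<open>v * M\<close> >= 4.\<close>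

lemma is_saddle_bounds:
  assumes "4 \<le> \<alpha>" "4 \<le> \<beta>" "is_saddle \<alpha> \<beta> g"
  shows "1 < g" "g < 2"
proof -
  have g: "g > 0" "g\<^sup>2 = saddle_rhs \<alpha> \<beta> g" using assms by (auto simp: is_saddle_iff)
  show "g < 2"
  proof (rule ccontr)
    assume "\<not> g < 2"
    then have "2\<^sup>2 \<le> g\<^sup>2" by (intro power_mono) auto
    then show False using saddle_rhs_less[of \<alpha> \<beta> g] g assms by simp
  qed
  show "1 < g"
  proof (rule ccontr)
    assume "\<not> 1 < g"
    then have "saddle_rhs \<alpha> \<beta> 1 / 1\<^sup>2 \<le> saddle_rhs \<alpha> \<beta> g / g\<^sup>2"
      using saddle_rhs_quotient_strict_antimono[of \<alpha> \<beta> g 1] assms g by (cases "g = 1") auto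
    then show False using saddle_rhs_1[OF assms(1,2)] g(1) unfolding g(2)[symmetric] by simp
  qed
qed

text \<open>Existence is the intermediate value theorem on [1, 2]; uniqueness is the strict decrease
  of the quotient by g^2. This makes the \<open>THE\<close> in \<open>saddle\<close>
  meaningful.\<close>

lemma ex1_saddle:
  assumes "4 \<le> \<alpha>" "4 \<le> \<beta>"
  shows "\<exists>!g. is_saddle \<alpha> \<beta> g"
proof (rule ex_ex1I)
  define f where "f x = saddle_rhs \<alpha> \<beta> x - x\<^sup>2" for x
  have a: "f 2 \<le> 0"
    using saddle_rhs_less[of \<alpha> \<beta> 2] assms by (simp add: f_def)
  have b: "0 \<le> f 1"
    using saddle_rhs_1[OF assms] by (simp add: f_def)
  have c: "continuous_on {1..2} f"
    unfolding saddle_rhs_def f_def using assms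
    by (intro continuous_intros continuous_on_compose2[OF continuous_on_debye])
      (auto intro!: continuous_intros)
  have "\<exists>x\<ge>1. x \<le> 2 \<and> f x = 0"
    using IVT2'[OF a b _ c] by simp
  then obtain g where "1 \<le> g" "f g = 0" by blast
  then show "\<exists>g. is_saddle \<alpha> \<beta> g"
    by (intro exI[of _ g]) (auto simp: is_saddle_iff f_def)
next
  fix g h assume gh: "is_saddle \<alpha> \<beta> g" "is_saddle \<alpha> \<beta> h"
  have q: "saddle_rhs \<alpha> \<beta> g / g\<^sup>2 = 1" "g > 0" if "is_saddle \<alpha> \<beta> g" for g
  proof -
    show "g > 0" using that by (simp add: is_saddle_iff)
    then have "g\<^sup>2 \<noteq> 0" by simp
    then show "saddle_rhs \<alpha> \<beta> g / g\<^sup>2 = 1" using that by (metis is_saddle_iff divide_self)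
  qed
  have "\<not> g < h" if "is_saddle \<alpha> \<beta> g" "is_saddle \<alpha> \<beta> h" for g h
    using saddle_rhs_quotient_strict_antimono[of \<alpha> \<beta> g h] q[OF that(1)] q[OF that(2)] assms
    by auto
  from this[OF gh] this[OF gh(2,1)] show "g = h" by simp
qed

lemma is_saddle_saddle:
  assumes "4 \<le> \<alpha>" "4 \<le> \<beta>"
  shows "is_saddle \<alpha> \<beta> (saddle \<alpha> \<beta>)"
  unfolding saddle_def by (rule theI'[OF ex1_saddle[OF assms]])

text \<open>The saddle equation trades the summand 2 g^2 for twice the combination of dilogarithms,
  which merges with the three quotients into values of \<open>debye2\<close>. In this form L is the
  leading coefficient of a variance.\<close>

lemma L_fun_eq_debye2:
  assumes "4 \<le> \<alpha>" "4 \<le> \<beta>"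
  defines "g \<equiv> saddle \<alpha> \<beta>"
  shows "L_fun \<alpha> \<beta> = debye2 (\<alpha> * g) + debye2 (\<beta> * g) - debye2 ((\<alpha> + \<beta>) * g)"
proof -
  have "g\<^sup>2 = saddle_rhs \<alpha> \<beta> g"
    using is_saddle_saddle[OF assms(1,2)] by (simp add: is_saddle_iff g_def)
  then show ?thesis
    unfolding L_fun_def Let_def g_def[symmetric]
    by (simp add: debye2_def saddle_rhs_def power_mult_distrib)
qed

text \<open>exp x - 1 >= x^2 / 2 + x^3 / 6 and x^3 >= 4 x^2 give exp x - 1 >= (7/6) x^2.\<close>

lemma square_div_exp_minus_one_le:
  fixes x :: real
  assumes "4 \<le> x"
  shows "x\<^sup>2 / (exp x - 1) \<le> 6/7"
proof -
  have "(\<Sum>k<4. x ^ k /\<^sub>R fact k) \<le> exp x"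
    unfolding exp_def by (rule sum_le_suminf[OF summable_exp_generic]) (use assms in auto)
  moreover have "(\<Sum>k<4. x ^ k /\<^sub>R fact k) = 1 + x + x\<^sup>2 / 2 + x ^ 3 / 6"
    by (simp add: eval_nat_numeral field_simps)
  ultimately have "1 + x + x\<^sup>2 / 2 + x ^ 3 / 6 \<le> exp x" by simp
  moreover have "4 * x\<^sup>2 \<le> x ^ 3"
    using assms by (simp add: power2_eq_square power3_eq_cube mult_right_mono)
  ultimately have "7/6 * x\<^sup>2 \<le> exp x - 1" using assms by simp
  then show ?thesis using assms by (simp add: field_simps)
qed

text \<open>With 1 <= g^2 <= 4 and every quotient in [0, 6/7], the extremes are 2 - 12/7 = 2/7 and 8
  + 6/7 < 9.\<close>

lemma L_fun_bounds:
  assumes "4 \<le> \<alpha>" "4 \<le> \<beta>"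
  shows "2/7 \<le> L_fun \<alpha> \<beta>" "L_fun \<alpha> \<beta> \<le> 9"
proof -
  define g where "g = saddle \<alpha> \<beta>"
  have g: "1 < g" "g < 2"
    using is_saddle_bounds[OF assms is_saddle_saddle[OF assms]] by (auto simp: g_def)
  have "g\<^sup>2 \<le> 2\<^sup>2" using g by (intro power_mono) auto
  then have g2: "1 \<le> g\<^sup>2" "g\<^sup>2 \<le> 4" using g by simp_all
  have ge: "4 \<le> c * g" if "4 \<le> c" for c
    using mult_mono[of 4 c 1 g] g that by simp
  have 1: "(\<alpha> * g)\<^sup>2 / (exp (\<alpha> * g) - 1) \<le> 6/7" "(\<beta> * g)\<^sup>2 / (exp (\<beta> * g) - 1) \<le> 6/7"
      "((\<alpha> + \<beta>) * g)\<^sup>2 / (exp ((\<alpha> + \<beta>) * g) - 1) \<le> 6/7"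
    using assms by (intro square_div_exp_minus_one_le ge; simp)+
  have 2: "0 \<le> (c * g)\<^sup>2 / (exp (c * g) - 1)" if "0 \<le> c" for c
    using that g by (intro square_div_exp_minus_one_bounds) auto
  have L: "L_fun \<alpha> \<beta> = 2 * g\<^sup>2 + ((\<alpha> + \<beta>) * g)\<^sup>2 / (exp ((\<alpha> + \<beta>) * g) - 1)
     - (\<alpha> * g)\<^sup>2 / (exp (\<alpha> * g) - 1) - (\<beta> * g)\<^sup>2 / (exp (\<beta> * g) - 1)"
    by (simp add: L_fun_def Let_def g_def power_mult_distrib)
  show "2/7 \<le> L_fun \<alpha> \<beta>" "L_fun \<alpha> \<beta> \<le> 9"
    unfolding L using 1 2[of \<alpha>] 2[of \<beta>] 2[of "\<alpha> + \<beta>"] g2 assms by linarith+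
qed

section \<open>Gaussian binomial coefficients\<close>

text \<open>The sum is left free, so that the generating function is a finite sum over this
  set.\<close>

definition box_partitions :: "nat \<Rightarrow> nat \<Rightarrow> nat multiset set" where
  "box_partitions N M = {P. (\<forall>x\<in>#P. 1 \<le> x \<and> x \<le> N) \<and> size P \<le> M}"

text \<open>The q-Pochhammer symbol (q; q)_k, without normalisation by powers of 1 - q.\<close>

definition qfact :: "'a::comm_ring_1 \<Rightarrow> nat \<Rightarrow> 'a" where
  "qfact q k = (\<Prod>j=1..k. 1 - q ^ j)"

lemma qfact_0 [simp]: "qfact q 0 = 1"
  by (simp add: qfact_def)

lemma qfact_Suc: "qfact q (Suc k) = (1 - q ^ Suc k) * qfact q k"
  by (simp add: qfact_def mult.commute)

lemma box_partitions_0_left [simp]: "box_partitions 0 M = {{#}}"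
proof -
  have "P = {#}" if "P \<in> box_partitions 0 M" for P
    using that by (cases P) (auto simp: box_partitions_def)
  then show ?thesis by (auto simp: box_partitions_def)
qed

lemma box_partitions_0_right [simp]: "box_partitions N 0 = {{#}}"
  by (auto simp: box_partitions_def)

text \<open>Either the largest admissible part \<open>Suc N\<close> is absent, or one copy of it can
  be removed: the combinatorial q-Pascal rule.\<close>

lemma box_partitions_Suc_Suc:
  "box_partitions (Suc N) (Suc M) =
     box_partitions N (Suc M) \<union> add_mset (Suc N) ` box_partitions (Suc N) M"
proof (intro equalityI subsetI)
  fix P assume P: "P \<in> box_partitions (Suc N) (Suc M)"
  show "P \<in> box_partitions N (Suc M) \<union> add_mset (Suc N) ` box_partitions (Suc N) M"
  proof (cases "Suc N \<in># P")
    case True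
    then obtain P' where "P = add_mset (Suc N) P'" by (rule mset_add)
    then show ?thesis using P by (auto simp: box_partitions_def)
  next
    case False
    then show ?thesis using P by (auto simp: box_partitions_def le_Suc_eq)
  qed
next
  fix P assume "P \<in> box_partitions N (Suc M) \<union> add_mset (Suc N) ` box_partitions (Suc N) M"
  then show "P \<in> box_partitions (Suc N) (Suc M)"
    by (auto simp: box_partitions_def le_Suc_eq)
qed

lemma finite_box_partitions: "finite (box_partitions N M)"
proof (induction N arbitrary: M)
  case (Suc N)
  show ?case
    by (induction M) (simp_all add: box_partitions_Suc_Suc Suc.IH)
qed simp

lemma sum_box_partitions_Suc_Suc:
  fixes q :: "'a::comm_ring_1"
  shows "(\<Sum>P\<in>box_partitions (Suc N) (Suc M). q ^ sum_mset P) =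
     (\<Sum>P\<in>box_partitions N (Suc M). q ^ sum_mset P) +
     q ^ Suc N * (\<Sum>P\<in>box_partitions (Suc N) M. q ^ sum_mset P)"
proof -
  have "box_partitions N (Suc M) \<inter> add_mset (Suc N) ` box_partitions (Suc N) M = {}"
    by (auto simp: box_partitions_def)
  then show ?thesis
    by (simp add: box_partitions_Suc_Suc sum.union_disjoint finite_box_partitions
        sum.reindex inj_on_def sum_distrib_left power_add mult_ac)
qed

text \<open>Induction along the q-Pascal rule: both neighbours multiply up to the same
  \<open>qfact\<close>, with weights that add up as (1 - q^(N+1)) + q^(N+1) (1 - q^(M+1)) = 1 -
  q^(N+M+2). The product form avoids division and holds in every commutative ring.\<close>

lemma sum_box_partitions_qfact:
  fixes q :: "'a::comm_ring_1"
  shows "(\<Sum>P\<in>box_partitions N M. q ^ sum_mset P) * (qfact q N * qfact q M) = qfact q (N + M)"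
proof (induction N arbitrary: M)
  case 0
  then show ?case by simp
next
  case (Suc N)
  show ?case
  proof (induction M)
    case 0
    then show ?case by simp
  next
    case (Suc M)
    define Z1 Z2 where "Z1 = (\<Sum>P\<in>box_partitions N (Suc M). q ^ sum_mset P)"
      and "Z2 = (\<Sum>P\<in>box_partitions (Suc N) M. q ^ sum_mset P)"
    have 1: "Z1 * (qfact q N * qfact q (Suc M)) = qfact q (Suc (N + M))"
      using Suc.prems \<open>\<And>M. _ = qfact q (N + M)\<close>[of "Suc M"] by (simp add: Z1_def)
    have 2: "Z2 * (qfact q (Suc N) * qfact q M) = qfact q (Suc (N + M))"
      using Suc.IH by (simp add: Z2_def)
    have "(Z1 + q ^ Suc N * Z2) * (qfact q (Suc N) * qfact q (Suc M)) =
        (1 - q ^ Suc N) * (Z1 * (qfact q N * qfact q (Suc M))) +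
        q ^ Suc N * (1 - q ^ Suc M) * (Z2 * (qfact q (Suc N) * qfact q M))"
      by (simp add: qfact_Suc algebra_simps)
    also have "\<dots> = (1 - q ^ Suc N * q ^ Suc M) * qfact q (Suc (N + M))"
      unfolding 1 2 by (simp add: algebra_simps)
    also have "\<dots> = qfact q (Suc N + Suc M)"
      using qfact_Suc[of q "Suc (N + M)"] by (simp add: power_add mult_ac)
    finally show ?case
      unfolding sum_box_partitions_Suc_Suc Z1_def Z2_def .
  qed
qed

lemma has_integral_cis_int:
  fixes k :: int
  shows "((\<lambda>t. cis (of_int k * t)) has_integral (if k = 0 then of_real (2 * pi) else 0)) {-pi..pi}"
proof (cases "k = 0")
  case True
  then show ?thesis
    using has_integral_const_real[of "1::complex" "-pi" pi] by (simp add: scaleR_conv_of_real)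
next
  case False
  define F where "F t = exp (\<i> * of_int k * of_real t) / (\<i> * of_int k)" for t :: real
  have "((\<lambda>t. cis (of_int k * t)) has_integral (F pi - F (-pi))) {-pi..pi}"
  proof (rule fundamental_theorem_of_calculus)
    fix x :: real
    show "(F has_vector_derivative cis (of_int k * x)) (at x within {-pi..pi})"
      unfolding F_def
      by (rule has_vector_derivative_real_field)
        (use False in \<open>auto intro!: derivative_eq_intros simp: cis_conv_exp mult_ac\<close>)
  qed simp
  moreover have "F pi = F (-pi)"
  proof -
    have "exp (\<i> * of_int k * of_real pi) = exp (\<i> * of_int k * of_real (-pi))"
      by (rule exp_eq[THEN iffD2]) (auto intro!: exI[of _ k] simp: algebra_simps)
    then show ?thesis by (simp add: F_def)
  qed
  ultimately show ?thesis using False by simp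
qed

lemma partition_count_eq_card:
  "partition_count n N M = card {P \<in> box_partitions N M. sum_mset P = n}"
  unfolding partition_count_def bounded_partitions_def box_partitions_def
  by (rule arg_cong[where f = card]) auto

text \<open>Orthogonality of the characters isolates the partitions with sum n. The radius stays
  free here; \<open>exp (- v)\<close> is inserted later.\<close>

lemma has_integral_partition_count:
  fixes r :: real
  shows "((\<lambda>t. (\<Sum>P\<in>box_partitions N M. (of_real r * cis t) ^ sum_mset P) * cis (- (real n * t)))
     has_integral of_real (2 * pi * (real (partition_count n N M) * r ^ n))) {-pi..pi}"
proof -
  have "(of_real r * cis t) ^ s * cis (- (real n * t)) =
      of_real (r ^ s) * cis (of_int (int s - int n) * t)" for s t
  proof -
    have "cis t ^ s * cis (- (real n * t)) = cis (of_int (int s - int n) * t)"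
      by (subst Complex.DeMoivre, subst cis_mult, rule arg_cong[where f = cis]) (simp add: left_diff_distrib)
    then show ?thesis by (simp add: power_mult_distrib mult.assoc)
  qed
  then have eq: "(\<Sum>P\<in>box_partitions N M. (of_real r * cis t) ^ sum_mset P) * cis (- (real n * t))
      = (\<Sum>P\<in>box_partitions N M. of_real (r ^ sum_mset P) * cis (of_int (int (sum_mset P) - int n) * t))" for t
    by (simp add: sum_distrib_right del: of_int_diff of_real_power)
  have "((\<lambda>t. \<Sum>P\<in>box_partitions N M. of_real (r ^ sum_mset P) * cis (of_int (int (sum_mset P) - int n) * t))
      has_integral (\<Sum>P\<in>box_partitions N M. of_real (r ^ sum_mset P) *
        (if int (sum_mset P) - int n = 0 then of_real (2 * pi) else 0))) {-pi..pi}"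
    by (intro has_integral_sum finite_box_partitions has_integral_mult_right has_integral_cis_int)
  moreover have "(\<Sum>P\<in>box_partitions N M. of_real (r ^ sum_mset P) *
        (if int (sum_mset P) - int n = 0 then of_real (2 * pi) else 0)) =
      (\<Sum>P\<in>{P \<in> box_partitions N M. sum_mset P = n}. complex_of_real (2 * pi * r ^ n))"
    by (rule sum.mono_neutral_cong_right) (auto simp: finite_box_partitions simp del: of_nat_sum_mset)
  ultimately show ?thesis
    unfolding eq partition_count_eq_card by (simp add: mult_ac del: of_nat_sum_mset)
qed

section \<open>Taylor expansion of the characteristic function\<close>

text \<open>On each step the increment of F lies between the values of v f at the two ends. The
  resulting error bound does not depend on \<open>X\<close>, which is the source of uniformity in N
  and M.\<close>

lemma riemann_sum_antimono:
  fixes F f :: "real \<Rightarrow> real"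
  assumes cont: "continuous_on {0..} F"
    and der: "\<And>x. 0 < x \<Longrightarrow> (F has_real_derivative f x) (at x)"
    and anti: "\<And>x y. 0 \<le> x \<Longrightarrow> x \<le> y \<Longrightarrow> f y \<le> f x"
    and nonneg: "\<And>x. 0 \<le> x \<Longrightarrow> 0 \<le> f x"
    and v: "0 < v"
  shows "\<bar>v * (\<Sum>j=1..X. f (v * real j)) - (F (v * real X) - F 0)\<bar> \<le> v * f 0"
proof -
  define e where "e X = F (v * real X) - F 0 - v * (\<Sum>j=1..X. f (v * real j))" for X
  \<comment> \<open>The bound v f(0) alone is not inductive; the sharper bound telescopes.\<close>
  have "0 \<le> e X \<and> e X \<le> v * (f 0 - f (v * real X))"
  proof (induction X)
    case 0
    then show ?case by (simp add: e_def)
  next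
    case (Suc X)
    define a b where "a = v * real X" and "b = v * real (Suc X)"
    have ab: "0 \<le> a" "a < b" "b - a = v"
      using v by (simp_all add: a_def b_def algebra_simps)
    obtain z where z: "a < z" "z < b" "F b - F a = (b - a) * f z"
    proof -
      have "\<exists>l z. a < z \<and> z < b \<and> (F has_real_derivative l) (at z) \<and> F b - F a = (b - a) * l"
      proof (rule MVT)
        show "continuous_on {a..b} F"
          by (rule continuous_on_subset[OF cont]) (use ab in auto)
        show "F differentiable (at x)" if "a < x" "x < b" for x
          using der[of x] that ab by (auto simp: real_differentiable_def)
      qed (use ab in auto)
      then obtain l z where "a < z" "z < b" "(F has_real_derivative l) (at z)" "F b - F a = (b - a) * l"
        by blast
      moreover from this ab have "l = f z"
        using DERIV_unique[OF _ der[of z]] by auto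
      ultimately show ?thesis using that by blast
    qed
    have "e (Suc X) = e X + v * f z - v * f b"
      using z(3) ab(3) by (simp add: e_def a_def b_def algebra_simps)
    moreover have "v * f b \<le> v * f z" "v * f z \<le> v * f a"
      using z ab v by (auto intro!: mult_left_mono anti)
    ultimately show ?case
      using Suc.IH unfolding a_def[symmetric] b_def[symmetric] right_diff_distrib by linarith
  qed
  moreover have "0 \<le> v * f (v * real X)"
    using v by (simp add: nonneg)
  ultimately show ?thesis by (simp add: e_def right_diff_distrib abs_le_iff)
qed

text \<open>Taylor's formula for Ln (1 - \<rho> exp (i x)) along the real points of the complex
  plane. The coefficients are the mean and variance of a geometric variable. The third derivative i
  z (1 + z) / (1 - z)^3 is at most 2 \<rho> / (1 - \<rho>)^3 in norm, and the 2 cancels the 2! in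
  the remainder of \<open>field_Taylor\<close>.\<close>

lemma norm_Ln_one_minus_taylor:
  fixes \<rho> t :: real
  assumes "0 < \<rho>" "\<rho> < 1"
  shows "norm (Ln (1 - of_real \<rho> * cis t) - Ln (1 - of_real \<rho>)
      + \<i> * of_real (t * (\<rho> / (1 - \<rho>))) - of_real (t\<^sup>2 / 2 * (\<rho> / (1 - \<rho>)\<^sup>2)))
    \<le> \<bar>t\<bar> ^ 3 * (\<rho> / (1 - \<rho>) ^ 3)"
proof -
  define z where "z x = of_real \<rho> * exp (\<i> * x)" for x :: complex
  define f where "f i x = (if i = 0 then Ln (1 - z x) else if i = 1 then - \<i> * z x / (1 - z x)
    else if i = 2 then z x / (1 - z x)\<^sup>2 else \<i> * z x * (1 + z x) / (1 - z x) ^ 3)" for i :: nat and x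
  have nz: "norm (z x) = \<rho>" if "x \<in> \<real>" for x
    using that assms by (auto simp: z_def norm_mult elim!: Reals_cases)
  have nz1: "1 - \<rho> \<le> norm (1 - z x)" if "x \<in> \<real>" for x
    using norm_triangle_ineq2[of 1 "z x"] nz[OF that] by simp
  have ne: "1 - z x \<noteq> 0" if "x \<in> \<real>" for x
    using nz1[OF that] assms by auto
  have dz: "(z has_field_derivative \<i> * z x) (at x within S)" for x S
    unfolding z_def by (auto intro!: derivative_eq_intros)
  have "norm (f 0 (of_real t) - (\<Sum>i\<le>2. f i 0 * (of_real t - 0) ^ i / fact i))
      \<le> (2 * \<rho> / (1 - \<rho>) ^ 3) * norm (of_real t - 0 :: complex) ^ Suc 2 / fact 2"
  proof (rule field_Taylor[of \<real>])
    show "convex (\<real> :: complex set)" by (rule convex_Reals)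
    fix i :: nat and x :: complex assume x: "x \<in> \<real>" and "i \<le> 2"
    then consider "i = 0" | "i = 1" | "i = 2" by linarith
    then show "(f i has_field_derivative f (Suc i) x) (at x within \<real>)"
    proof cases
      case 1
      have "Re (z x) < 1"
        using complex_Re_le_cmod[of "z x"] nz[OF x] assms by linarith
      then have "1 - z x \<notin> \<real>\<^sub>\<le>\<^sub>0"
        by (auto simp: complex_nonpos_Reals_iff)
      with 1 show ?thesis
        by (auto simp: f_def[abs_def] divide_inverse mult_ac intro!: derivative_eq_intros dz)
    next
      case 2
      then show ?thesis
        using ne[OF x] by (auto simp: f_def[abs_def] power2_eq_square field_simps intro!: derivative_eq_intros dz)
    next
      case 3
      have "((\<lambda>x. z x / (1 - z x)\<^sup>2) has_field_derivative
          (\<i> * z x * (1 - z x)\<^sup>2 - z x * (2 * (1 - z x) * - (\<i> * z x))) / ((1 - z x)\<^sup>2 * (1 - z x)\<^sup>2))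
          (at x within \<real>)"
        using ne[OF x] by (auto intro!: derivative_eq_intros dz)
      moreover have "(\<i> * z x * w\<^sup>2 - z x * (2 * w * - (\<i> * z x))) / (w\<^sup>2 * w\<^sup>2) =
          \<i> * z x * (w + 2 * z x) / w ^ 3" if "w \<noteq> 0" for w
        using that by (simp add: divide_simps power2_eq_square power3_eq_cube) (simp add: algebra_simps)
      note this[OF ne[OF x]]
      moreover have "1 - z x + 2 * z x = 1 + z x" by simp
      ultimately have "((\<lambda>x. z x / (1 - z x)\<^sup>2) has_field_derivative
          \<i> * z x * (1 + z x) / (1 - z x) ^ 3) (at x within \<real>)" by simp
      with 3 show ?thesis
        by (simp add: f_def[abs_def])
    qed
  next
    fix x :: complex assume x: "x \<in> \<real>"
    have "norm (f (Suc 2) x) = \<rho> * norm (1 + z x) / norm (1 - z x) ^ 3"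
      using nz[OF x] by (simp add: f_def norm_mult norm_divide norm_power)
    also have "norm (1 + z x) \<le> 2"
      using norm_triangle_ineq[of 1 "z x"] nz[OF x] assms by simp
    then have "\<rho> * norm (1 + z x) / norm (1 - z x) ^ 3 \<le> \<rho> * 2 / (1 - \<rho>) ^ 3"
      using nz1[OF x] assms by (intro frac_le mult_left_mono power_mono) auto
    finally show "norm (f (Suc 2) x) \<le> 2 * \<rho> / (1 - \<rho>) ^ 3" by (simp add: mult_ac)
  qed auto
  moreover have "(\<Sum>i\<le>2. f i 0 * (of_real t - 0) ^ i / fact i) =
      Ln (1 - of_real \<rho>) - \<i> * of_real (t * (\<rho> / (1 - \<rho>))) + of_real (t\<^sup>2 / 2 * (\<rho> / (1 - \<rho>)\<^sup>2))"
    by (simp add: f_def z_def numeral_2_eq_2 mult_ac)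
  moreover have "(2 * \<rho> / (1 - \<rho>) ^ 3) * norm (of_real t - 0 :: complex) ^ Suc 2 / fact 2 =
      \<bar>t\<bar> ^ 3 * (\<rho> / (1 - \<rho>) ^ 3)"
    by (simp add: numeral_3_eq_3 numeral_2_eq_2)
  moreover have "f 0 (of_real t) = Ln (1 - of_real \<rho> * cis t)"
    by (simp add: f_def z_def cis_conv_exp)
  ultimately show ?thesis by (simp only: diff_add_eq diff_diff_eq2 diff_diff_eq)
qed

text \<open>x / (1 - exp (- x)) <= 1 + x <= 6 exp (x / 6). The sixth is chosen so that the cube
  costs exp (x / 2), half of the available decay, and 6^3 = 216.\<close>

lemma cube_div_one_minus_exp_le:
  fixes x :: real
  assumes "0 < x"
  shows "x ^ 3 * (exp (- x) / (1 - exp (- x)) ^ 3) \<le> 216 * exp (- x / 2)"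
proof -
  have "1 + x \<le> exp x" by simp
  then have "x \<le> (1 + x) * (1 - exp (- x))"
    using assms by (simp add: exp_minus field_simps)
  then have "x / (1 - exp (- x)) \<le> 1 + x"
    using assms by (simp add: field_simps)
  also have "1 + x \<le> 6 * exp (x / 6)"
    using exp_ge_add_one_self[of "x/6"] by linarith
  finally have "(x / (1 - exp (- x))) ^ 3 \<le> (6 * exp (x / 6)) ^ 3"
    using assms by (intro power_mono) auto
  then have "(x / (1 - exp (- x))) ^ 3 * exp (- x) \<le> (6 * exp (x / 6)) ^ 3 * exp (- x)"
    by (intro mult_right_mono) auto
  also have "\<dots> = 216 * exp (- x / 2)"
    by (simp add: power_mult_distrib flip: exp_of_nat_mult exp_add)
  finally show ?thesis by (simp add: power_divide)
qed

lemma sum_exp_le: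
  fixes v :: real
  assumes "0 < v"
  shows "(\<Sum>j=1..X. exp (- (v * real j))) \<le> 1 / v"
proof -
  define y where "y = exp (- v)"
  have y: "0 < y" "y < 1" using assms by (auto simp: y_def)
  have "(\<Sum>j=1..X. y ^ j) * (1 - y) = y - y ^ Suc X"
    by (induction X) (simp_all add: left_diff_distrib distrib_right right_diff_distrib)
  then have "(\<Sum>j=1..X. y ^ j) = (y - y ^ Suc X) / (1 - y)" using y by (simp add: field_simps)
  also have "\<dots> \<le> y / (1 - y)" using y by (intro divide_right_mono) auto
  also have "\<dots> = 1 / (exp v - 1)"
    using assms by (simp add: y_def exp_minus field_simps)
  also have "\<dots> \<le> 1 / v"
    using exp_ge_add_one_self[of v] assms
    by (intro divide_left_mono) (simp_all add: algebra_simps)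
  finally show ?thesis by (simp add: y_def mult_ac flip: exp_of_nat_mult)
qed

text \<open>A sum of principal logarithms instead of the logarithm of the product: for v > 0 every
  factor has positive real part, so no branch cut is met as t varies.\<close>

definition ln_qfact :: "real \<Rightarrow> nat \<Rightarrow> real \<Rightarrow> complex" where
  "ln_qfact v X t = (\<Sum>j=1..X. Ln (1 - of_real (exp (- (v * real j))) * cis (real j * t)))"

text \<open>The j-th factor turns by the angle j t. Its cubic remainder is |t|^3 / v^3 times a
  function of v j bounded by 216 exp (- v j / 2), and the geometric sum contributes 2 / v.\<close>

lemma ln_qfact_taylor:
  assumes v: "0 < v"
  shows "norm (ln_qfact v X t - ln_qfact v X 0
      + \<i> * of_real (t * ((\<Sum>j=1..X. bose (v * real j)) / v))
      - of_real (t\<^sup>2 / 2 * ((\<Sum>j=1..X. bose2 (v * real j)) / v\<^sup>2))) \<le> 432 * \<bar>t\<bar> ^ 3 / v ^ 4"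
proof -
  define \<rho> where "\<rho> j = exp (- (v * real j))" for j
  have \<rho>: "0 < \<rho> j" "\<rho> j < 1" if "1 \<le> j" for j using that v by (auto simp: \<rho>_def)
  define T where "T j = Ln (1 - of_real (\<rho> j) * cis (real j * t)) - Ln (1 - of_real (\<rho> j))
      + \<i> * of_real (real j * t * (\<rho> j / (1 - \<rho> j))) - of_real ((real j * t)\<^sup>2 / 2 * (\<rho> j / (1 - \<rho> j)\<^sup>2))" for j
  have b1: "real j * (\<rho> j / (1 - \<rho> j)) = bose (v * real j) / v"
    and b2: "(real j)\<^sup>2 * (\<rho> j / (1 - \<rho> j)\<^sup>2) = bose2 (v * real j) / v\<^sup>2" if "1 \<le> j" for j
  proof -
    have *: "exp (v * real j) - 1 \<noteq> 0" using that v by auto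
    show "real j * (\<rho> j / (1 - \<rho> j)) = bose (v * real j) / v"
      using that v * by (simp add: \<rho>_def bose_def exp_minus field_simps)
    show "(real j)\<^sup>2 * (\<rho> j / (1 - \<rho> j)\<^sup>2) = bose2 (v * real j) / v\<^sup>2"
    proof -
      define E where "E = exp (v * real j)"
      have E: "E > 0" "E - 1 \<noteq> 0" using * by (auto simp: E_def)
      then have "1 / E / (1 - 1 / E)\<^sup>2 = E / (E - 1)\<^sup>2"
        by (simp add: divide_simps power2_eq_square)
      then show ?thesis
        using that v by (simp add: \<rho>_def bose2_def exp_minus' power_mult_distrib flip: E_def)
    qed
  qed
  have "ln_qfact v X t - ln_qfact v X 0
      + \<i> * of_real (t * ((\<Sum>j=1..X. bose (v * real j)) / v))
      - of_real (t\<^sup>2 / 2 * ((\<Sum>j=1..X. bose2 (v * real j)) / v\<^sup>2)) = (\<Sum>j=1..X. T j)"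
  proof -
    have "(\<Sum>j=1..X. T j) = (\<Sum>j=1..X. Ln (1 - of_real (\<rho> j) * cis (real j * t)) - Ln (1 - of_real (\<rho> j))
        + \<i> * of_real (t * (bose (v * real j) / v)) - of_real (t\<^sup>2 / 2 * (bose2 (v * real j) / v\<^sup>2)))"
    proof (rule sum.cong[OF refl])
      fix j assume "j \<in> {1..X}"
      then have j: "1 \<le> j" by simp
      have "real j * t * (\<rho> j / (1 - \<rho> j)) = t * (bose (v * real j) / v)"
        unfolding b1[OF j, symmetric] by simp
      moreover have "(real j * t)\<^sup>2 / 2 * (\<rho> j / (1 - \<rho> j)\<^sup>2) = t\<^sup>2 / 2 * (bose2 (v * real j) / v\<^sup>2)"
        unfolding b2[OF j, symmetric] by (simp add: power_mult_distrib)
      ultimately show "T j = Ln (1 - of_real (\<rho> j) * cis (real j * t)) - Ln (1 - of_real (\<rho> j))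
        + \<i> * of_real (t * (bose (v * real j) / v)) - of_real (t\<^sup>2 / 2 * (bose2 (v * real j) / v\<^sup>2))"
        by (simp only: T_def)
    qed
    then show ?thesis
      by (simp add: ln_qfact_def \<rho>_def sum.distrib sum_subtractf sum_distrib_left sum_divide_distrib)
  qed
  also have "norm \<dots> \<le> (\<Sum>j=1..X. \<bar>t\<bar> ^ 3 / v ^ 3 * (216 * exp (- (v / 2 * real j))))"
  proof (rule sum_norm_le)
    fix j assume "j \<in> {1..X}"
    then have j: "1 \<le> j" by simp
    have "norm (T j) \<le> \<bar>real j * t\<bar> ^ 3 * (\<rho> j / (1 - \<rho> j) ^ 3)"
      unfolding T_def by (rule norm_Ln_one_minus_taylor) (use \<rho>[OF j] in auto)
    also have "\<dots> = \<bar>t\<bar> ^ 3 / v ^ 3 * ((v * real j) ^ 3 * (\<rho> j / (1 - \<rho> j) ^ 3))"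
      using v by (simp add: abs_mult power_mult_distrib)
    also have "\<dots> \<le> \<bar>t\<bar> ^ 3 / v ^ 3 * (216 * exp (- (v * real j) / 2))"
      unfolding \<rho>_def using j v by (intro mult_left_mono cube_div_one_minus_exp_le) auto
    finally show "norm (T j) \<le> \<bar>t\<bar> ^ 3 / v ^ 3 * (216 * exp (- (v / 2 * real j)))" by simp
  qed
  also have "\<dots> = \<bar>t\<bar> ^ 3 / v ^ 3 * (216 * (\<Sum>j=1..X. exp (- (v / 2 * real j))))"
    by (simp only: sum_distrib_left)
  also have "\<dots> \<le> \<bar>t\<bar> ^ 3 / v ^ 3 * (216 * (1 / (v / 2)))"
    using v by (intro mult_left_mono sum_exp_le) auto
  also have "\<dots> = 432 * \<bar>t\<bar> ^ 3 / v ^ 4"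
    using v by (simp add: power4_eq_xxxx power3_eq_cube)
  finally show ?thesis .
qed

text \<open>The sums over \<open>bose\<close> and \<open>bose2\<close> are replaced by integrals.
  Each Riemann sum is off by at most v, since both functions start at 1, which produces the linear
  and quadratic error terms.\<close>

lemma ln_qfact_expansion:
  assumes v: "0 < v"
  shows "norm (ln_qfact v X t - ln_qfact v X 0
      + \<i> * of_real (t * (debye (v * real X) / v\<^sup>2))
      - of_real (t\<^sup>2 / 2 * (debye2 (v * real X) / v ^ 3)))
    \<le> \<bar>t\<bar> / v + t\<^sup>2 / (2 * v\<^sup>2) + 432 * \<bar>t\<bar> ^ 3 / v ^ 4"
proof -
  define s1 s2 where "s1 = (\<Sum>j=1..X. bose (v * real j))" and "s2 = (\<Sum>j=1..X. bose2 (v * real j))"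
  have 1: "\<bar>v * s1 - debye (v * real X)\<bar> \<le> v"
    using riemann_sum_antimono[OF continuous_on_debye DERIV_debye bose_antimono bose_nonneg v, of X]
    by (simp add: s1_def) (simp add: bose_def)
  have 2: "\<bar>v * s2 - debye2 (v * real X)\<bar> \<le> v"
    using riemann_sum_antimono[OF continuous_on_debye2 DERIV_debye2 bose2_antimono bose2_nonneg v, of X]
    by (simp add: s2_def) (simp add: bose2_def)
  define d1 d2 where "d1 = debye (v * real X) / v\<^sup>2 - s1 / v" and "d2 = debye2 (v * real X) / v ^ 3 - s2 / v\<^sup>2"
  have d1: "\<bar>d1\<bar> \<le> 1 / v"
  proof -
    have "d1 = - ((v * s1 - debye (v * real X)) / v\<^sup>2)"
      using v by (simp add: d1_def field_simps power2_eq_square)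
    then have "\<bar>d1\<bar> = \<bar>v * s1 - debye (v * real X)\<bar> / v\<^sup>2" by simp
    also have "\<dots> \<le> v / v\<^sup>2" using 1 by (intro divide_right_mono) auto
    finally show ?thesis using v by (simp add: power2_eq_square)
  qed
  have d2: "\<bar>d2\<bar> \<le> 1 / v\<^sup>2"
  proof -
    have "d2 = - ((v * s2 - debye2 (v * real X)) / v ^ 3)"
      using v by (simp add: d2_def field_simps power2_eq_square power3_eq_cube)
    then have "\<bar>d2\<bar> = \<bar>v * s2 - debye2 (v * real X)\<bar> / v ^ 3" using v by (simp add: abs_divide)
    also have "\<dots> \<le> v / v ^ 3" using 2 v by (intro divide_right_mono) auto
    finally show ?thesis using v by (simp add: power2_eq_square power3_eq_cube)
  qed
  have "ln_qfact v X t - ln_qfact v X 0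
      + \<i> * of_real (t * (debye (v * real X) / v\<^sup>2)) - of_real (t\<^sup>2 / 2 * (debye2 (v * real X) / v ^ 3))
    = (ln_qfact v X t - ln_qfact v X 0 + \<i> * of_real (t * (s1 / v)) - of_real (t\<^sup>2 / 2 * (s2 / v\<^sup>2)))
      + (\<i> * of_real (t * d1) - of_real (t\<^sup>2 / 2 * d2))"
    unfolding d1_def d2_def by (simp only: right_diff_distrib of_real_diff) simp
  also have "norm \<dots> \<le> 432 * \<bar>t\<bar> ^ 3 / v ^ 4 + (\<bar>t\<bar> / v + t\<^sup>2 / (2 * v\<^sup>2))"
  proof (rule norm_triangle_mono)
    show "norm (ln_qfact v X t - ln_qfact v X 0 + \<i> * of_real (t * (s1 / v)) - of_real (t\<^sup>2 / 2 * (s2 / v\<^sup>2)))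
        \<le> 432 * \<bar>t\<bar> ^ 3 / v ^ 4"
      unfolding s1_def s2_def by (rule ln_qfact_taylor[OF v])
    have "norm (\<i> * of_real (t * d1) - of_real (t\<^sup>2 / 2 * d2))
        \<le> norm (\<i> * of_real (t * d1)) + norm (of_real (t\<^sup>2 / 2 * d2) :: complex)"
      by (rule norm_triangle_ineq4)
    also have "\<dots> = \<bar>t\<bar> * \<bar>d1\<bar> + t\<^sup>2 / 2 * \<bar>d2\<bar>"
      by (simp only: norm_mult norm_of_real norm_ii abs_mult) simp
    also have "\<dots> \<le> \<bar>t\<bar> * (1 / v) + t\<^sup>2 / 2 * (1 / v\<^sup>2)"
      using d1 d2 by (intro add_mono mult_left_mono) auto
    finally show "norm (\<i> * of_real (t * d1) - of_real (t\<^sup>2 / 2 * d2)) \<le> \<bar>t\<bar> / v + t\<^sup>2 / (2 * v\<^sup>2)" by simp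
  qed
  finally show ?thesis by simp
qed

section \<open>Decay of the characteristic function\<close>

text \<open>The difference is the series of \<rho>^n (1 - cos (n x)) / n. All its terms are
  nonnegative and only n = 1 is kept.\<close>

lemma ln_norm_one_minus_ge:
  fixes \<rho> x :: real
  assumes "0 < \<rho>" "\<rho> < 1"
  shows "\<rho> * (1 - cos x) \<le> Re (Ln (1 - of_real \<rho> * cis x)) - ln (1 - \<rho>)"
proof -
  have "(\<lambda>n. Re (- ((of_real \<rho> * cis x) ^ n) / of_nat n)) sums Re (Ln (1 - of_real \<rho> * cis x))"
    using Ln_series'[of "- (of_real \<rho> * cis x)"] assms by (intro sums_Re) (simp add: norm_mult)
  moreover have "Re (- ((of_real \<rho> * cis x) ^ n) / of_nat n) = - (\<rho> ^ n * cos (real n * x)) / real n" for n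
  proof -
    have "(of_real \<rho> * cis x) ^ n = of_real (\<rho> ^ n) * cis (real n * x)"
      by (simp add: power_mult_distrib Complex.DeMoivre)
    then show ?thesis by (simp add: Re_divide_of_nat)
  qed
  ultimately have "(\<lambda>n. - (\<rho> ^ n * cos (real n * x)) / real n) sums Re (Ln (1 - of_real \<rho> * cis x))"
    by (simp only:)
  moreover have "(\<lambda>n. - (\<rho> ^ n) / real n) sums ln (1 - \<rho>)"
    using ln_series'[of "- \<rho>"] assms by simp
  ultimately have "(\<lambda>n. - (\<rho> ^ n * cos (real n * x)) / real n - - (\<rho> ^ n) / real n)
      sums (Re (Ln (1 - of_real \<rho> * cis x)) - ln (1 - \<rho>))"
    by (rule sums_diff)
  also have "(\<lambda>n. - (\<rho> ^ n * cos (real n * x)) / real n - - (\<rho> ^ n) / real n) =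
      (\<lambda>n. \<rho> ^ n * (1 - cos (real n * x)) / real n)"
    by (simp add: diff_divide_distrib right_diff_distrib)
  finally have S: "(\<lambda>n. \<rho> ^ n * (1 - cos (real n * x)) / real n)
      sums (Re (Ln (1 - of_real \<rho> * cis x)) - ln (1 - \<rho>))" .
  have "(\<Sum>n\<in>{1}. \<rho> ^ n * (1 - cos (real n * x)) / real n) \<le> (\<Sum>n. \<rho> ^ n * (1 - cos (real n * x)) / real n)"
    using assms S by (intro sum_le_suminf) (auto simp: sums_iff)
  then show ?thesis using S by (simp add: sums_iff)
qed

lemma norm_one_minus_cis_power2:
  fixes \<rho> x :: real
  shows "(norm (1 - of_real \<rho> * cis x))\<^sup>2 = (1 - \<rho>)\<^sup>2 + 2 * \<rho> * (1 - cos x)"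
proof -
  have "(norm (1 - of_real \<rho> * cis x))\<^sup>2 = (1 - \<rho> * cos x)\<^sup>2 + (\<rho> * sin x)\<^sup>2"
    by (simp add: cmod_power2)
  also have "\<dots> = 1 - 2 * \<rho> * cos x + \<rho>\<^sup>2 * ((sin x)\<^sup>2 + (cos x)\<^sup>2)"
    by (simp only: power2_eq_square) (simp only: algebra_simps)
  finally show ?thesis by (simp add: power2_eq_square algebra_simps)
qed

text \<open>Since |1 - \<rho> cis x|^2 = (1 - \<rho>)^2 (1 + A), this is ln (1 + A) <= A. Compared
  with the lower bound it loses the factor (1 - \<rho>)^(-2), harmless for small \<rho>.\<close>

lemma ln_norm_one_minus_le:
  fixes \<rho> x :: real
  assumes "0 < \<rho>" "\<rho> < 1"
  shows "Re (Ln (1 - of_real \<rho> * cis x)) - ln (1 - \<rho>) \<le> \<rho> * (1 - cos x) / (1 - \<rho>)\<^sup>2"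
proof -
  define A where "A = 2 * \<rho> * (1 - cos x) / (1 - \<rho>)\<^sup>2"
  have A: "0 \<le> A" using assms by (simp add: A_def)
  have "1 - \<rho> \<le> norm (1 - of_real \<rho> * cis x)"
    using norm_triangle_ineq2[of 1 "of_real \<rho> * cis x"] assms by (simp add: norm_mult)
  then have nz: "1 - of_real \<rho> * cis x \<noteq> 0" using assms by auto
  then have "2 * Re (Ln (1 - of_real \<rho> * cis x)) = ln ((norm (1 - of_real \<rho> * cis x))\<^sup>2)"
    by (simp add: ln_realpow)
  also have "(norm (1 - of_real \<rho> * cis x))\<^sup>2 = (1 - \<rho>)\<^sup>2 * (1 + A)"
    unfolding norm_one_minus_cis_power2 A_def using assms by (simp add: field_simps)
  also have "ln \<dots> = 2 * ln (1 - \<rho>) + ln (1 + A)"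
    using assms A by (simp add: ln_mult ln_realpow)
  also have "ln (1 + A) \<le> A"
    using A by (rule ln_add_one_self_le_self)
  finally show ?thesis by (simp add: A_def)
qed

section \<open>Trigonometric estimates and tails of geometric sums\<close>

lemma abs_sin_mult_le: "\<bar>sin (real m * x)\<bar> \<le> real m * \<bar>sin x\<bar>"
proof (induction m)
  case (Suc m)
  have "\<bar>sin (real (Suc m) * x)\<bar> = \<bar>sin (real m * x) * cos x + cos (real m * x) * sin x\<bar>"
    by (simp add: distrib_right sin_add algebra_simps)
  also have "\<dots> \<le> \<bar>sin (real m * x)\<bar> * \<bar>cos x\<bar> + \<bar>cos (real m * x)\<bar> * \<bar>sin x\<bar>"
    by (rule order_trans[OF abs_triangle_ineq]) (simp add: abs_mult)
  also have "\<dots> \<le> \<bar>sin (real m * x)\<bar> * 1 + 1 * \<bar>sin x\<bar>"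
    by (intro add_mono mult_mono) auto
  also have "\<dots> \<le> real m * \<bar>sin x\<bar> + \<bar>sin x\<bar>"
    using Suc.IH by simp
  finally show ?case by (simp add: distrib_right add.commute)
qed simp

lemma one_minus_cos_eq: "1 - cos t = 2 * (sin (t / 2))\<^sup>2" for t :: real
  using cos_double_sin[of "t/2"] by simp

lemma one_minus_cos_mult_le: "1 - cos (real m * t) \<le> (real m)\<^sup>2 * (1 - cos t)"
proof -
  have "\<bar>sin (real m * (t / 2))\<bar>\<^sup>2 \<le> (real m * \<bar>sin (t / 2)\<bar>)\<^sup>2"
    by (intro power_mono abs_sin_mult_le) auto
  then show ?thesis
    by (simp add: one_minus_cos_eq power_mult_distrib)
qed

text \<open>On [0, 8/5], which contains [0, pi / 2], the cubic Taylor bound gives sin x >= x (1 -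
  (64/25) / 6) >= x / 2.\<close>

lemma one_minus_cos_ge:
  assumes "\<bar>t\<bar> \<le> pi"
  shows "t\<^sup>2 / 8 \<le> 1 - cos t"
proof -
  define x where "x = \<bar>t\<bar> / 2"
  have x: "0 \<le> x" "x \<le> 8/5" using assms pi_less_3_2 by (auto simp: x_def)
  have "\<bar>sin x - (\<Sum>m<3. sin_coeff m * x ^ m)\<bar> \<le> inverse (fact 3) * \<bar>x\<bar> ^ 3"
    by (rule Maclaurin_sin_bound)
  then have "\<bar>sin x - x\<bar> \<le> x ^ 3 / 6"
    using x by (simp add: eval_nat_numeral sin_coeff_def field_simps)
  then have "x - x ^ 3 / 6 \<le> sin x" by linarith
  moreover have "x ^ 3 \<le> x * (8/5)\<^sup>2"
    unfolding power3_eq_cube power2_eq_square mult.assoc using x by (intro mult_mono) auto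
  ultimately have "x / 2 \<le> sin x" using x by (simp add: power2_eq_square)
  then have "(x / 2)\<^sup>2 \<le> (sin x)\<^sup>2" using x by (intro power_mono) auto
  moreover have "(sin x)\<^sup>2 = (sin (t / 2))\<^sup>2" by (simp add: x_def abs_if)
  moreover have "(x / 2)\<^sup>2 = t\<^sup>2 / 16" by (simp add: x_def power_divide)
  ultimately show ?thesis unfolding one_minus_cos_eq by simp
qed

text \<open>The real part of a geometric series, with denominator |1 - r cis t|^2 = s^2 + 2 r w. It
  evaluates the decay that infinitely many denominator factors would supply; the finite product is
  treated as this minus a tail.\<close>

lemma sums_geometric_one_minus_cos:
  fixes r t :: real
  assumes "0 < r" "r < 1"
  defines "s \<equiv> 1 - r" and "w \<equiv> 1 - cos t"
  shows "(\<lambda>j. r ^ j * (1 - cos (real j * t))) sums (r * (1 + r) * w / (s * (s\<^sup>2 + 2 * r * w)))"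
proof -
  define q where "q = of_real r * cis t"
  have "(\<lambda>j. Re (q ^ j)) sums Re (1 / (1 - q))"
    using assms by (intro sums_Re geometric_sums) (simp add: q_def norm_mult)
  moreover have "Re (q ^ j) = r ^ j * cos (real j * t)" for j
    by (simp add: q_def power_mult_distrib Complex.DeMoivre flip: of_real_power)
  moreover have "Re (1 / (1 - q)) = (1 - r * cos t) / (s\<^sup>2 + 2 * r * w)"
  proof -
    have "Re (1 / (1 - q)) = Re (1 - q) / (norm (1 - q))\<^sup>2"
      by (simp add: Re_divide cmod_power2)
    then show ?thesis
      unfolding q_def norm_one_minus_cis_power2 by (simp add: s_def w_def)
  qed
  ultimately have 1: "(\<lambda>j. r ^ j * cos (real j * t)) sums ((1 - r * cos t) / (s\<^sup>2 + 2 * r * w))"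
    by simp
  have 2: "(\<lambda>j. r ^ j) sums (1 / s)"
    using geometric_sums[of r] assms by (simp add: s_def)
  have "(\<lambda>j. r ^ j - r ^ j * cos (real j * t)) sums (1 / s - (1 - r * cos t) / (s\<^sup>2 + 2 * r * w))"
    by (rule sums_diff[OF 2 1])
  moreover have "1 / s - (1 - r * cos t) / (s\<^sup>2 + 2 * r * w) = r * (1 + r) * w / (s * (s\<^sup>2 + 2 * r * w))"
  proof -
    have s: "0 < s" using assms by simp
    moreover have "0 \<le> w" by (simp add: w_def)
    ultimately have d: "s\<^sup>2 + 2 * r * w > 0" using assms by (simp add: add_pos_nonneg)
    have "1 / s - (1 - r * cos t) / (s\<^sup>2 + 2 * r * w) =
        ((s\<^sup>2 + 2 * r * w) - (1 - r * cos t) * s) / (s * (s\<^sup>2 + 2 * r * w))"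
      using s d by (simp add: diff_frac_eq mult_ac)
    also have "(s\<^sup>2 + 2 * r * w) - (1 - r * cos t) * s = r * (1 + r) * w"
      by (simp add: s_def w_def power2_eq_square algebra_simps)
    finally show ?thesis .
  qed
  ultimately show ?thesis by (simp add: right_diff_distrib)
qed

lemma sum_telescope_le:
  fixes f U :: "nat \<Rightarrow> real"
  assumes "\<And>k. f (Suc k) \<le> U k - U (Suc k)" "\<And>k. 0 \<le> U k" "K \<le> J"
  shows "(\<Sum>j=Suc K..J. f j) \<le> U K"
proof -
  have "(\<Sum>j=Suc K..J. f j) \<le> U K - U J"
    using assms(3)
  proof (induction J rule: dec_induct)
    case (step J)
    then show ?case using assms(1)[of J] by simp
  qed simp
  then show ?thesis using assms(2)[of J] by linarith
qed

text \<open>The bound is modelled on the integral of x^2 exp (- x) from a to infinity, exp (- a)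
  (a^2 + 2 a + 2), at a = K s. Its decrements dominate the summands.\<close>

lemma sum_square_power_le:
  fixes r :: real
  assumes "0 < r" "r < 1" "K \<le> J"
  defines "s \<equiv> 1 - r"
  shows "(\<Sum>j=Suc K..J. (real j)\<^sup>2 * r ^ j) \<le> r ^ K * ((real K * s)\<^sup>2 + 2 * (real K * s) + 2) / s ^ 3"
proof (rule sum_telescope_le[where U = "\<lambda>K. r ^ K * ((real K * s)\<^sup>2 + 2 * (real K * s) + 2) / s ^ 3"])
  have s: "0 < s" using assms by simp
  show "0 \<le> r ^ k * ((real k * s)\<^sup>2 + 2 * (real k * s) + 2) / s ^ 3" for k
    using s assms by simp
  show "(real (Suc k))\<^sup>2 * r ^ Suc k \<le> r ^ k * ((real k * s)\<^sup>2 + 2 * (real k * s) + 2) / s ^ 3 -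
      r ^ Suc k * ((real (Suc k) * s)\<^sup>2 + 2 * (real (Suc k) * s) + 2) / s ^ 3" for k
  proof -
    define a where "a = real (Suc k)"
    have rs: "r = 1 - s" and k: "real k = a - 1" by (simp_all add: s_def a_def)
    have "r ^ k * ((real k * s)\<^sup>2 + 2 * (real k * s) + 2) / s ^ 3 -
        r ^ Suc k * ((a * s)\<^sup>2 + 2 * (a * s) + 2) / s ^ 3
      = r ^ k * ((((a - 1) * s)\<^sup>2 + 2 * ((a - 1) * s) + 2) - (1 - s) * ((a * s)\<^sup>2 + 2 * (a * s) + 2)) / s ^ 3"
      unfolding k power_Suc by (simp add: rs[symmetric] algebra_simps diff_divide_distrib add_divide_distrib)
    also have "(((a - 1) * s)\<^sup>2 + 2 * ((a - 1) * s) + 2) - (1 - s) * ((a * s)\<^sup>2 + 2 * (a * s) + 2)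
        = s\<^sup>2 + a\<^sup>2 * s ^ 3"
      by (simp add: power2_eq_square power3_eq_cube algebra_simps)
    also have "r ^ k * (s\<^sup>2 + a\<^sup>2 * s ^ 3) / s ^ 3 = r ^ k * (1 / s + a\<^sup>2)"
      using s by (simp add: field_simps power2_eq_square power3_eq_cube)
    also have "\<dots> \<ge> r ^ Suc k * a\<^sup>2"
    proof -
      have "r ^ Suc k * a\<^sup>2 \<le> r ^ k * a\<^sup>2"
        using assms by (intro mult_right_mono power_decreasing) auto
      also have "\<dots> \<le> r ^ k * (1 / s + a\<^sup>2)"
        using s assms by (intro mult_left_mono) auto
      finally show ?thesis .
    qed
    finally show ?thesis by (simp add: a_def mult_ac)
  qed
qed (use assms in auto)

lemma sum_power_le:
  fixes r :: real
  assumes "0 < r" "r < 1" "K \<le> J"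
  shows "(\<Sum>j=Suc K..J. r ^ j) \<le> r ^ K / (1 - r)"
proof (rule sum_telescope_le[where U = "\<lambda>K. r ^ K / (1 - r)"])
  fix k
  have "r ^ k / (1 - r) - r ^ Suc k / (1 - r) = r ^ k"
  proof -
    have "r ^ k - r ^ Suc k = r ^ k * (1 - r)" by (simp add: right_diff_distrib)
    then have "r ^ k / (1 - r) - r ^ Suc k / (1 - r) = r ^ k * (1 - r) / (1 - r)"
      by (simp only: diff_divide_distrib[symmetric])
    also have "\<dots> = r ^ k" using assms by simp
    finally show ?thesis .
  qed
  moreover have "r ^ Suc k \<le> r ^ k"
    using assms by (intro power_decreasing) auto
  ultimately show "r ^ Suc k \<le> r ^ k / (1 - r) - r ^ Suc k / (1 - r)" by simp
qed (use assms in auto)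

text \<open>The derivative is - x^2 exp (- x), so the maximum is at 4, where 26 exp (- 4) <
  26/50.\<close>

lemma exp_minus_mult_quadratic_le:
  fixes x :: real
  assumes "4 \<le> x"
  shows "exp (- x) * (x\<^sup>2 + 2 * x + 2) \<le> 13/25"
proof -
  have "exp (- x) * (x\<^sup>2 + 2 * x + 2) \<le> exp (- 4) * (4\<^sup>2 + 2 * 4 + 2)"
  proof (rule DERIV_nonpos_imp_nonincreasing[where f = "\<lambda>x::real. exp (- x) * (x\<^sup>2 + 2 * x + 2)", OF assms])
    fix y :: real
    have "((\<lambda>x. exp (- x) * (x\<^sup>2 + 2 * x + 2)) has_real_derivative - (exp (- y) * y\<^sup>2)) (at y)"
      by (auto intro!: derivative_eq_intros simp: algebra_simps)
    then show "\<exists>d. ((\<lambda>x. exp (- x) * (x\<^sup>2 + 2 * x + 2)) has_real_derivative d) (at y) \<and> d \<le> 0"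
      by (intro exI conjI) auto
  qed
  also have "exp (- 4) < (1/50 :: real)"
    using exp_4_gt by (simp add: exp_minus field_simps)
  then have "exp (- 4) * (4\<^sup>2 + 2 * 4 + 2) \<le> (13/25 :: real)" by simp
  finally show ?thesis .
qed

lemma exp_minus_le_one_fiftieth: "exp (- x) \<le> 1/50" if "4 \<le> x" for x :: real
proof -
  have "exp (- x) \<le> exp (- 4)" using that by simp
  also have "\<dots> < 1/50" using exp_4_gt by (simp add: exp_minus field_simps)
  finally show ?thesis by simp
qed

text \<open>The first bound uses 1 - cos (j t) <= j^2 (1 - cos t) and is good for small t; the
  second uses 1 - cos <= 2 and gives 2 * (1/50) / s for all t. Both are needed, because the decay
  itself saturates at order 1 / s.\<close>

lemma sum_tail_bounds:
  fixes v t :: real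
  assumes "0 < v" "4 \<le> v * real K" "K \<le> J"
  defines "r \<equiv> exp (- v)" and "s \<equiv> 1 - exp (- v)"
  shows "(\<Sum>j=Suc K..J. r ^ j * (1 - cos (real j * t))) \<le> 13/25 * (1 - cos t) / s ^ 3"
    and "(\<Sum>j=Suc K..J. r ^ j * (1 - cos (real j * t))) \<le> 1/25 / s"
proof -
  have r: "0 < r" "r < 1" and s: "0 < s" "s = 1 - r" using assms by auto
  have rK: "r ^ K = exp (- (v * real K))" by (simp add: r_def mult_ac flip: exp_of_nat_mult)
  have sv: "s \<le> v" using exp_ge_add_one_self[of "-v"] by (simp add: s_def)
  have "(\<Sum>j=Suc K..J. r ^ j * (1 - cos (real j * t))) \<le> (\<Sum>j=Suc K..J. (1 - cos t) * ((real j)\<^sup>2 * r ^ j))"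
  proof (rule sum_mono)
    fix j
    have "r ^ j * (1 - cos (real j * t)) \<le> r ^ j * ((real j)\<^sup>2 * (1 - cos t))"
      using r by (intro mult_left_mono one_minus_cos_mult_le) auto
    then show "r ^ j * (1 - cos (real j * t)) \<le> (1 - cos t) * ((real j)\<^sup>2 * r ^ j)" by (simp add: mult_ac)
  qed
  also have "\<dots> = (1 - cos t) * (\<Sum>j=Suc K..J. (real j)\<^sup>2 * r ^ j)" by (simp only: sum_distrib_left)
  also have "\<dots> \<le> (1 - cos t) * (r ^ K * ((real K * s)\<^sup>2 + 2 * (real K * s) + 2) / s ^ 3)"
    unfolding s(2) using r assms by (intro mult_left_mono sum_square_power_le) auto
  also have "\<dots> \<le> (1 - cos t) * ((13/25) / s ^ 3)"
  proof (intro mult_left_mono divide_right_mono)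
    have Ks: "real K * s \<le> v * real K" "0 \<le> real K * s"
      using sv s(1) mult_left_mono[OF sv, of "real K"] by (simp_all add: mult.commute)
    have "r ^ K * ((real K * s)\<^sup>2 + 2 * (real K * s) + 2) \<le>
        exp (- (v * real K)) * ((v * real K)\<^sup>2 + 2 * (v * real K) + 2)"
      unfolding rK using Ks by (intro mult_left_mono add_mono power_mono order_refl) auto
    also have "\<dots> \<le> 13/25" by (rule exp_minus_mult_quadratic_le) (use assms in auto)
    finally show "r ^ K * ((real K * s)\<^sup>2 + 2 * (real K * s) + 2) \<le> 13/25" .
  qed (use s in auto)
  finally show "(\<Sum>j=Suc K..J. r ^ j * (1 - cos (real j * t))) \<le> 13/25 * (1 - cos t) / s ^ 3"
    by (simp add: mult_ac)
  have "(\<Sum>j=Suc K..J. r ^ j * (1 - cos (real j * t))) \<le> (\<Sum>j=Suc K..J. 2 * r ^ j)"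
  proof (rule sum_mono)
    fix j
    have "1 - cos (real j * t) \<le> 2" using cos_ge_minus_one[of "real j * t"] by linarith
    then have "r ^ j * (1 - cos (real j * t)) \<le> r ^ j * 2" using r by (intro mult_left_mono) auto
    then show "r ^ j * (1 - cos (real j * t)) \<le> 2 * r ^ j" by (simp add: mult_ac)
  qed
  also have "\<dots> = 2 * (\<Sum>j=Suc K..J. r ^ j)" by (simp only: sum_distrib_left)
  also have "\<dots> \<le> 2 * (r ^ K / (1 - r))"
    using r assms by (intro mult_left_mono sum_power_le) auto
  also have "\<dots> \<le> 2 * ((1/50) / s)"
    unfolding rK s(2)[symmetric] using exp_minus_le_one_fiftieth[OF assms(2)] s
    by (intro mult_left_mono divide_right_mono) auto
  finally show "(\<Sum>j=Suc K..J. r ^ j * (1 - cos (real j * t))) \<le> 1/25 / s" by simp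
qed


section \<open>Denominator against numerator of the Gaussian binomial\<close>

lemma Re_ln_qfact_diff:
  assumes "0 < v"
  shows "Re (ln_qfact v X t) - Re (ln_qfact v X 0) =
    (\<Sum>j=1..X. Re (Ln (1 - of_real (exp (- (v * real j))) * cis (real j * t))) - ln (1 - exp (- (v * real j))))"
proof -
  have "Re (Ln (1 - of_real (exp (- (v * real j))))) = ln (1 - exp (- (v * real j)))" if "j \<in> {1..X}" for j
  proof -
    have "0 < 1 - exp (- (v * real j))" using that assms by simp
    from Ln_of_real[OF this] show ?thesis by simp
  qed
  then show ?thesis
    by (simp add: ln_qfact_def Re_sum sum_subtractf)
qed

text \<open>In the variable y = w / s^2 both sides are of order min y 1 / s. The factor 41/20 = 1 +
  21/20 counts the tail missing beyond N and the numerator factors beyond M. For y <= 1/4 the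
  coefficient left is 97/75 - (41/20) (13/25) > 1/5; for y > 1/4 the constant left is 97/300 -
  (41/20) / 25 > 1/5.\<close>

lemma decay_rate_ge:
  fixes r s w :: real
  assumes "49/50 \<le> r" "0 < s" "r = 1 - s" "0 \<le> w"
  shows "1/5 * min (w / s ^ 3) (1 / s) \<le>
    r * (1 + r) * w / (s * (s\<^sup>2 + 2 * r * w)) - 41/20 * min (13/25 * w / s ^ 3) (1/25 / s)"
proof -
  define y where "y = w / s\<^sup>2"
  have y: "0 \<le> y" "w = y * s\<^sup>2" using assms by (simp_all add: y_def)
  have r: "0 < r" "r < 1" using assms by auto
  have "1 + 2 * r * y > 0" using r y by (simp add: add_pos_nonneg)
  have e1: "r * (1 + r) * w / (s * (s\<^sup>2 + 2 * r * w)) = (r * (1 + r) * y / (1 + 2 * r * y)) / s"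
  proof -
    have "r * (1 + r) * w / (s * (s\<^sup>2 + 2 * r * w)) = (s\<^sup>2 * (r * (1 + r) * y)) / (s\<^sup>2 * ((1 + 2 * r * y) * s))"
      unfolding y(2) by (rule arg_cong2[of _ _ _ _ "(/)"]) (simp_all add: algebra_simps)
    then show ?thesis using assms by simp
  qed
  have e2: "w / s ^ 3 = y / s" using assms by (simp add: y_def power2_eq_square power3_eq_cube)
  have e3: "13/25 * w / s ^ 3 = 13/25 * y / s" using e2 by (simp only: times_divide_eq_right[symmetric])
  have lb: "97/50 * y / (1 + 2 * y) \<le> r * (1 + r) * y / (1 + 2 * r * y)"
  proof (rule frac_le)
    have "49/50 * (1 + 49/50) \<le> r * (1 + r)" using assms by (intro mult_mono) auto
    then have "97/50 \<le> r * (1 + r)" by simp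
    then show "97/50 * y \<le> r * (1 + r) * y" using y by (intro mult_right_mono) auto
    show "1 + 2 * r * y \<le> 1 + 2 * y" using r y by (simp add: mult_left_le_one_le)
  qed (use r y \<open>1 + 2 * r * y > 0\<close> in auto)
  have main: "1/5 * min y 1 \<le> r * (1 + r) * y / (1 + 2 * r * y) - 41/20 * min (13/25 * y) (1/25)"
  proof (cases "y \<le> 1/4")
    case True
    have "97/75 * y = 97/50 * y / (3/2)" by simp
    also have "\<dots> \<le> 97/50 * y / (1 + 2 * y)"
      using True y by (intro divide_left_mono) auto
    also note lb
    finally have "97/75 * y \<le> r * (1 + r) * y / (1 + 2 * r * y)" .
    moreover have "1/5 * min y 1 \<le> 1/5 * y" "41/20 * min (13/25 * y) (1/25) \<le> 41/20 * (13/25 * y)"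
      by auto
    ultimately show ?thesis using y by linarith
  next
    case False
    have "97/300 \<le> 97/50 * y / (1 + 2 * y)"
      using False by (simp add: field_simps)
    also note lb
    finally have "97/300 \<le> r * (1 + r) * y / (1 + 2 * r * y)" .
    moreover have "1/5 * min y 1 \<le> 1/5" "41/20 * min (13/25 * y) (1/25) \<le> 41/20 * (1/25)"
      by auto
    ultimately show ?thesis by linarith
  qed
  have "(1/5 * min y 1) / s \<le> (r * (1 + r) * y / (1 + 2 * r * y) - 41/20 * min (13/25 * y) (1/25)) / s"
    using main assms by (intro divide_right_mono) auto
  moreover have "min (w / s ^ 3) (1 / s) = min y 1 / s"
    unfolding e2 using assms by (simp add: min_divide_distrib_right)
  moreover have "min (13/25 * w / s ^ 3) (1/25 / s) = min (13/25 * y) (1/25) / s"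
    unfolding e3 using assms by (simp only: min_divide_distrib_right) simp
  ultimately show ?thesis
    unfolding e1 by (simp add: diff_divide_distrib)
qed

lemma ln_qfact_char_decay:
  fixes v t :: real and N M :: nat
  assumes v: "0 < v" "v \<le> 1/50" and N: "4 \<le> v * real N" and M: "4 \<le> v * real M"
    and t: "\<bar>t\<bar> \<le> pi"
  defines "A \<equiv> \<lambda>t. ln_qfact v (N + M) t - ln_qfact v N t - ln_qfact v M t"
  shows "exp (Re (A t - A 0)) \<le> exp (- (t\<^sup>2 / (40 * v ^ 3))) + exp (- (1 / (5 * v)))"
proof -
  define r s w where "r = exp (- v)" and "s = 1 - exp (- v)" and "w = 1 - cos t"
  have r: "0 < r" "r < 1" "r = 1 - s" and s: "0 < s" using v by (auto simp: r_def s_def)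
  have sv: "s \<le> v" using exp_ge_add_one_self[of "-v"] by (simp add: s_def)
  have r98: "49/50 \<le> r" using sv v r by linarith
  have w: "0 \<le> w" by (simp add: w_def)
  define f where "f j = r ^ j * (1 - cos (real j * t))" for j
  define h where "h j = Re (Ln (1 - of_real (exp (- (v * real j))) * cis (real j * t)))
      - ln (1 - exp (- (v * real j)))" for j
  have rj: "exp (- (v * real j)) = r ^ j" for j
    by (simp add: r_def mult_ac flip: exp_of_nat_mult)
  have rj1: "0 < r ^ j \<and> r ^ j < 1" if "1 \<le> j" for j
    using r that by (auto simp: power_less_one_iff)
  have f_nonneg: "0 \<le> f j" for j using r by (simp add: f_def)
  define B where "B = min (13/25 * w / s ^ 3) (1/25 / s)"
  have tail: "(\<Sum>j=Suc K..J. f j) \<le> B" if "4 \<le> v * real K" "K \<le> J" for K J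
    using sum_tail_bounds[OF v(1) that, of t] by (simp add: f_def B_def r_def s_def w_def)
  have h_ge: "f j \<le> h j" if "1 \<le> j" for j
    unfolding f_def h_def rj using rj1[OF that] by (intro ln_norm_one_minus_ge) auto
  \<comment> \<open>For r^j <= 1/50 the loss (1 - r^j)^(-2) is at most (50/49)^2 <= 21/20.\<close>
  have h_le: "h j \<le> 21/20 * f j" if "Suc M \<le> j" for j
  proof -
    have "4 \<le> v * real j" using that M v(1)
      by (meson Suc_leD less_eq_real_def mult_left_mono of_nat_le_iff order_trans)
    then have "r ^ j \<le> 1/50" using exp_minus_le_one_fiftieth by (simp add: rj[symmetric])
    then have "(49/50)\<^sup>2 \<le> (1 - r ^ j)\<^sup>2" by (intro power_mono) auto
    then have "20/21 \<le> (1 - r ^ j)\<^sup>2" by (simp add: power2_eq_square)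
    have "h j \<le> f j / (1 - r ^ j)\<^sup>2"
      unfolding f_def h_def rj using rj1[of j] that by (intro ln_norm_one_minus_le) auto
    also have "\<dots> \<le> f j / (20/21)"
      using \<open>20/21 \<le> _\<close> f_nonneg[of j] by (intro divide_left_mono) auto
    finally show ?thesis by simp
  qed
  define S where "S = r * (1 + r) * w / (s * (s\<^sup>2 + 2 * r * w))"
  \<comment> \<open>Every partial sum of the full series is at most the first N terms plus one tail,
    hence so is its limit.\<close>
  have S: "S \<le> (\<Sum>j=1..N. f j) + B"
  proof (rule LIMSEQ_le_const2)
    have "f sums S"
      using sums_geometric_one_minus_cos[of r t] r
      by (simp add: f_def[abs_def] S_def w_def s_def r_def)
    then show "(\<lambda>n. \<Sum>j<n. f j) \<longlonglongrightarrow> S" by (simp add: sums_def)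
    show "\<exists>k. \<forall>n\<ge>k. (\<Sum>j<n. f j) \<le> (\<Sum>j=1..N. f j) + B"
    proof (intro exI allI impI)
      fix n assume n: "n \<ge> N"
      have "(\<Sum>j<n. f j) \<le> (\<Sum>j\<in>{0} \<union> ({1..N} \<union> {Suc N..n}). f j)"
        by (rule sum_mono2) (auto simp: f_nonneg)
      also have "\<dots> = f 0 + ((\<Sum>j=1..N. f j) + (\<Sum>j=Suc N..n. f j))"
        by (subst sum.union_disjoint; simp)+
      also have "f 0 = 0" by (simp add: f_def)
      finally show "(\<Sum>j<n. f j) \<le> (\<Sum>j=1..N. f j) + B"
        using tail[OF N n] by linarith
    qed
  qed
  have "Re (A t - A 0) = (\<Sum>j=1..N + M. h j) - (\<Sum>j=1..N. h j) - (\<Sum>j=1..M. h j)"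
    using Re_ln_qfact_diff[OF v(1), of "N + M" t] Re_ln_qfact_diff[OF v(1), of N t] Re_ln_qfact_diff[OF v(1), of M t]
    unfolding h_def[symmetric] by (simp add: A_def)
  \<comment> \<open>The factors j <= M of the numerator cancel against one denominator; only small
    factors with j > M survive and have to be beaten by the other denominator.\<close>
  also have "(\<Sum>j=1..N + M. h j) = (\<Sum>j=1..M. h j) + (\<Sum>j=Suc M..N + M. h j)"
  proof -
    have "{1..N + M} = {1..M} \<union> {Suc M..N + M}" by auto
    then show ?thesis by (simp add: sum.union_disjoint)
  qed
  also have "(\<Sum>j=Suc M..N + M. h j) \<le> (\<Sum>j=Suc M..N + M. 21/20 * f j)"
    by (intro sum_mono h_le) auto
  also have "\<dots> = 21/20 * (\<Sum>j=Suc M..N + M. f j)" by (simp only: sum_distrib_left)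
  also have "(\<Sum>j=Suc M..N + M. f j) \<le> B" by (rule tail[OF M]) simp
  finally have "Re (A t - A 0) \<le> 21/20 * B - (\<Sum>j=1..N. h j)" by simp
  also have "(\<Sum>j=1..N. f j) \<le> (\<Sum>j=1..N. h j)"
    by (intro sum_mono h_ge) auto
  then have "21/20 * B - (\<Sum>j=1..N. h j) \<le> - (S - 41/20 * B)"
    using S by linarith
  also have "\<dots> \<le> - (1/5 * min (w / s ^ 3) (1 / s))"
    using decay_rate_ge[OF r98 s r(3) w] by (simp add: S_def B_def)
  finally have le: "Re (A t - A 0) \<le> - (1/5 * min (w / s ^ 3) (1 / s))" .
  have s3: "s ^ 3 \<le> v ^ 3" using sv s by (intro power_mono) auto
  have "1/5 * (1 / v) \<le> 1/5 * (1 / s)"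
    using sv s by (intro mult_left_mono divide_left_mono) auto
  moreover have "t\<^sup>2 / (40 * v ^ 3) \<le> 1/5 * (w / s ^ 3)"
  proof -
    have "(t\<^sup>2 / 8) / v ^ 3 \<le> w / s ^ 3"
      using one_minus_cos_ge[OF t] s s3 v w by (intro frac_le) (auto simp: w_def)
    then show ?thesis by simp
  qed
  \<comment> \<open>Whichever term attains the minimum, the corresponding exponential is one of the
    two summands of the claim.\<close>
  ultimately have "Re (A t - A 0) \<le> - (t\<^sup>2 / (40 * v ^ 3)) \<or> Re (A t - A 0) \<le> - (1 / (5 * v))"
    using le by (auto simp: min_def split: if_splits)
  then show ?thesis
    by (auto intro: add_increasing add_increasing2)
qed

section \<open>Asymptotics of the q-factorial\<close>

text \<open>As the right endpoint t moves, the error has derivative (t - a) / 2 times an increment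
  of f', which is nonnegative for convex f. Bounding it by the increment of f' over the whole
  interval makes the errors telescope over equal steps.\<close>

lemma trapezoid_error:
  fixes F f d :: "real \<Rightarrow> real"
  assumes ab: "a < b"
    and F: "\<And>x. a \<le> x \<Longrightarrow> x \<le> b \<Longrightarrow> (F has_real_derivative f x) (at x)"
    and f: "\<And>x. a \<le> x \<Longrightarrow> x \<le> b \<Longrightarrow> (f has_real_derivative d x) (at x)"
    and d: "\<And>x y. a \<le> x \<Longrightarrow> x \<le> y \<Longrightarrow> y \<le> b \<Longrightarrow> d x \<le> d y"
  shows "0 \<le> (b - a) * (f a + f b) / 2 - (F b - F a)"
    and "(b - a) * (f a + f b) / 2 - (F b - F a) \<le> (b - a)\<^sup>2 / 2 * (d b - d a)"
proof -
  define E where "E t = (t - a) * (f a + f t) / 2 - (F t - F a)" for t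
  define E' where "E' t = (f a - f t) / 2 + (t - a) * d t / 2" for t
  have DE: "(E has_real_derivative E' t) (at t)" if "a \<le> t" "t \<le> b" for t
    unfolding E_def E'_def
    by (auto intro!: derivative_eq_intros F[OF that] f[OF that] simp: field_simps)
  have E': "0 \<le> E' t \<and> E' t \<le> (b - a) / 2 * (d b - d a)" if t: "a < t" "t < b" for t
  proof -
    obtain z where z: "a < z" "z < t" "f t - f a = (t - a) * d z"
      using MVT2[of a t f d] t f by force
    have eq: "E' t = (t - a) / 2 * (d t - d z)"
      using z(3) by (simp add: E'_def field_simps)
    have "0 \<le> d t - d z" "d t - d z \<le> d b - d a"
      using d[of z t] d[of a z] d[of t b] z t by auto
    then show ?thesis unfolding eq
      using t by (auto intro!: mult_mono)
  qed
  obtain z where z: "a < z" "z < b" "E b - E a = (b - a) * E' z"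
    using MVT2[of a b E E'] ab DE by force
  then have "E b = (b - a) * E' z" by (simp add: E_def)
  moreover have "(b - a) * E' z \<le> (b - a) * ((b - a) / 2 * (d b - d a))"
    using E'[OF z(1,2)] ab by (intro mult_left_mono) auto
  ultimately show "0 \<le> (b - a) * (f a + f b) / 2 - (F b - F a)"
    "(b - a) * (f a + f b) / 2 - (F b - F a) \<le> (b - a)\<^sup>2 / 2 * (d b - d a)"
    using E'[OF z(1,2)] ab by (auto simp: E_def power2_eq_square)
qed

definition stirling_rem :: "nat \<Rightarrow> real" where
  "stirling_rem n = ln (fact n) - (real n * ln (real n) - real n + ln (real n) / 2)"

text \<open>The trapezoidal rule for the convex function - ln on [n, n + 1]. The two monotone
  sequences \<open>stirling_rem n\<close> and \<open>stirling_rem n - 1 / (2 * real n)\<close>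
  enclose their common limit with an explicit error.\<close>

lemma stirling_rem_step:
  assumes "1 \<le> n"
  shows "stirling_rem (Suc n) \<le> stirling_rem n"
    and "stirling_rem n - 1 / (2 * real n) \<le> stirling_rem (Suc n) - 1 / (2 * real (Suc n))"
proof -
  define a b where "a = real n" and "b = real (Suc n)"
  define F where "F x = - (x * ln x - x)" for x :: real
  have ab: "0 < a" "a < b" "b - a = 1" using assms by (auto simp: a_def b_def)
  note trap = trapezoid_error[of a b F "\<lambda>x. - ln x" "\<lambda>x. - (1 / x)"]
  have 1: "(F has_real_derivative - ln x) (at x)" "((\<lambda>x. - ln x) has_real_derivative - (1 / x)) (at x)"
    if "a \<le> x" for x
    unfolding F_def using that ab by (auto intro!: derivative_eq_intros)
  have 2: "- (1 / x) \<le> - (1 / y)" if "a \<le> x" "x \<le> y" for x y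
    using that ab by (auto intro!: divide_left_mono)
  have E: "(b - a) * (- ln a + - ln b) / 2 - (F b - F a) = stirling_rem n - stirling_rem (Suc n)"
  proof -
    have "ln (fact (Suc n) :: real) = ln b + ln (fact n)"
      by (simp add: b_def ln_mult)
    then show ?thesis
      unfolding ab(3) stirling_rem_def F_def a_def[symmetric] b_def[symmetric]
      by (simp add: field_simps)
  qed
  have "0 \<le> stirling_rem n - stirling_rem (Suc n)"
    using trap(1)[OF ab(2) 1(1) 1(2) 2] unfolding E by simp
  then show "stirling_rem (Suc n) \<le> stirling_rem n" by simp
  have "stirling_rem n - stirling_rem (Suc n) \<le> 1 / 2 * (1 / a - 1 / b)"
    using trap(2)[OF ab(2) 1(1) 1(2) 2] unfolding E by (simp add: ab(3))
  then show "stirling_rem n - 1 / (2 * real n) \<le> stirling_rem (Suc n) - 1 / (2 * real (Suc n))"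
    unfolding a_def[symmetric] b_def[symmetric] by (simp add: field_simps)
qed

lemma wallis_product_eq:
  "(\<Prod>k=1..n. (4 * real k ^ 2) / (4 * real k ^ 2 - 1)) =
     2 ^ (4 * n) * fact n ^ 4 / (fact (2 * n) ^ 2 * (2 * real n + 1))"
proof (induction n)
  case (Suc n)
  define m where "m = real n"
  have m: "0 \<le> m" by (simp add: m_def)
  have f2: "(fact (2 * Suc n) :: real) = (2 * m + 2) * (2 * m + 1) * fact (2 * n)"
    by (simp add: m_def algebra_simps)
  have f1: "(fact (Suc n) :: real) = (m + 1) * fact n"
    by (simp add: m_def algebra_simps)
  have d: "4 * (m + 1)\<^sup>2 - 1 = (2 * m + 1) * (2 * m + 3)"
    by (simp add: power2_eq_square algebra_simps)
  have "(\<Prod>k=1..Suc n. (4 * real k ^ 2) / (4 * real k ^ 2 - 1)) =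
      2 ^ (4 * n) * fact n ^ 4 / (fact (2 * n) ^ 2 * (2 * m + 1)) * (4 * (m + 1)\<^sup>2 / (4 * (m + 1)\<^sup>2 - 1))"
    using Suc.IH by (simp add: m_def add.commute)
  also have "\<dots> = 2 ^ (4 * Suc n) * fact (Suc n) ^ 4 / (fact (2 * Suc n) ^ 2 * (2 * real (Suc n) + 1))"
  proof -
    define u v p where "u = (fact n :: real)" and "v = (fact (2 * n) :: real)" and "p = (2::real) ^ (4 * n)"
    have nz: "v \<noteq> 0" "2 * m + 1 \<noteq> 0" "2 * m + 3 \<noteq> 0" "m + 1 \<noteq> 0"
      using m by (auto simp: v_def)
    have p: "(2::real) ^ (4 * Suc n) = 16 * p" by (simp add: p_def power_add)
    have "p * u ^ 4 / (v\<^sup>2 * (2 * m + 1)) * (4 * (m + 1)\<^sup>2 / ((2 * m + 1) * (2 * m + 3))) =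
        16 * p * ((m + 1) * u) ^ 4 / (((2 * (m + 1)) * (2 * m + 1) * v)\<^sup>2 * (2 * m + 3))"
      using nz by (simp add: divide_simps power_mult_distrib power4_eq_xxxx power2_eq_square)
        (simp add: algebra_simps)
    then show ?thesis
      unfolding d f1 f2 p u_def[symmetric] v_def[symmetric] p_def[symmetric]
      by (simp add: m_def algebra_simps)
  qed
  finally show ?case .
qed simp

text \<open>Wallis' product identifies the constant: ln (W n) is 4 times the remainder at n minus
  twice the remainder at 2 n, up to an explicit term tending to ln (1/4). Hence 2 C = ln (pi / 2) +
  ln 4.\<close>

lemma stirling_rem_LIMSEQ: "(\<lambda>n. stirling_rem (Suc n)) \<longlonglongrightarrow> ln (2 * pi) / 2"
proof -
  define c where "c n = stirling_rem (Suc n)" for n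
  have dec: "decseq c"
    unfolding decseq_Suc_iff c_def using stirling_rem_step(1) by simp
  have "incseq (\<lambda>n. c n - 1 / (2 * real (Suc n)))"
    unfolding incseq_Suc_iff c_def by (intro allI stirling_rem_step(2)) simp
  then have "c 0 - 1/2 \<le> c n - 1 / (2 * real (Suc n))" for n
    by (drule_tac incseqD[of _ 0 n]) simp_all
  then have lb: "c 0 - 1/2 \<le> c n" for n
    using order_trans[of "c 0 - 1/2" "c n - 1 / (2 * real (Suc n))" "c n"] by simp
  obtain C where C: "c \<longlonglongrightarrow> C"
    using decseq_convergent[OF dec] lb by blast
  then have C0: "stirling_rem \<longlonglongrightarrow> C"
    unfolding c_def by (rule LIMSEQ_imp_Suc)
  have C2: "(\<lambda>n. stirling_rem (2 * n)) \<longlonglongrightarrow> C"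
    using LIMSEQ_subseq_LIMSEQ[OF C0, of "\<lambda>n. 2 * n"] by (simp add: strict_mono_def o_def)
  define W where "W n = (\<Prod>k=1..n. (4 * real k ^ 2) / (4 * real k ^ 2 - 1))" for n
  have W: "(\<lambda>n. ln (W n)) \<longlonglongrightarrow> ln (pi / 2)"
    using wallis unfolding W_def by (intro tendsto_ln) auto
  have lim: "(\<lambda>n. 4 * stirling_rem n - 2 * stirling_rem (2 * n) + ln (1 / (2 * (2 + 1 / real n))))
      \<longlonglongrightarrow> 4 * C - 2 * C + ln (1 / (2 * (2 + 0)))"
    by (intro tendsto_intros C0 C2 lim_1_over_n) auto
  have "eventually (\<lambda>n. 4 * stirling_rem n - 2 * stirling_rem (2 * n) + ln (1 / (2 * (2 + 1 / real n)))
      = ln (W n)) sequentially"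
    using eventually_gt_at_top[of 0]
  proof eventually_elim
    case (elim n)
    then have n: "0 < real n" by simp
    have "ln (W n) = ln (2 ^ (4 * n) * fact n ^ 4) - ln (fact (2 * n) ^ 2 * (2 * real n + 1))"
      unfolding W_def wallis_product_eq
      by (intro ln_divide_pos mult_pos_pos zero_less_power fact_gt_zero) auto
    also have "ln (2 ^ (4 * n) * fact n ^ 4 :: real) = 4 * real n * ln 2 + 4 * ln (fact n)"
      by (subst ln_mult_pos) (simp_all add: ln_realpow)
    also have "ln (fact (2 * n) ^ 2 * (2 * real n + 1)) = 2 * ln (fact (2 * n)) + ln (2 * real n + 1)"
      by (subst ln_mult_pos) (simp_all add: ln_realpow)
    finally have 1: "ln (W n) = 4 * real n * ln 2 + 4 * ln (fact n) -
        (2 * ln (fact (2 * n)) + ln (2 * real n + 1))" .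
    have 2: "ln (1 / (2 * (2 + 1 / real n))) = ln (real n) - ln 2 - ln (2 * real n + 1)"
    proof -
      have eq: "1 / (2 * (2 + 1 / real n)) = real n / (2 * (2 * real n + 1))"
        using n by (simp add: field_simps)
      have ln_div2: "ln (real n / (2 * y)) = ln (real n) - ln 2 - ln y" if "0 < y" for y :: real
        using n that by (simp add: ln_div ln_mult)
      show ?thesis unfolding eq by (rule ln_div2) simp
    qed
    have 3: "real (2 * n) = 2 * real n" "ln (2 * real n) = ln 2 + ln (real n)"
      using n by (simp_all add: ln_mult_pos)
    \<comment> \<open>The bookkeeping is proved for arbitrary reals, so that the logarithms and
      factorials act as opaque atoms.\<close>
    have "4 * (F - (x * l - x + l / 2)) - 2 * (F' - (2 * x * (l' + l) - 2 * x + (l' + l) / 2)) + (l - l' - m)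
        = 4 * x * l' + 4 * F - (2 * F' + m)" for F F' x l l' m :: real
      by (simp add: algebra_simps diff_divide_distrib add_divide_distrib)
    then show ?case unfolding 1 2 stirling_rem_def 3 .
  qed
  from Lim_transform_eventually[OF lim this]
  have "(\<lambda>n. ln (W n)) \<longlonglongrightarrow> 4 * C - 2 * C + ln (1 / (2 * (2 + 0)))" .
  from LIMSEQ_unique[OF this W]
  have "2 * C = ln (pi / 2) - ln (1 / 4)" by simp
  also have "\<dots> = ln (2 * pi)"
    using ln_div[of "pi/2" "1/4"] by simp
  finally have "C = ln (2 * pi) / 2" by simp
  with C have "c \<longlonglongrightarrow> ln (2 * pi) / 2" by (simp only:)
  then show ?thesis unfolding c_def[abs_def] .
qed

lemma stirling_rem_bounds:
  assumes "1 \<le> n"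
  shows "ln (2 * pi) / 2 \<le> stirling_rem n" "stirling_rem n \<le> ln (2 * pi) / 2 + 1 / (2 * real n)"
proof -
  obtain m where m: "n = Suc m" using assms by (cases n) auto
  have "decseq (\<lambda>n. stirling_rem (Suc n))"
    unfolding decseq_Suc_iff using stirling_rem_step(1) by simp
  from decseq_ge[OF this stirling_rem_LIMSEQ, of m]
  show "ln (2 * pi) / 2 \<le> stirling_rem n" by (simp add: m)
  have "incseq (\<lambda>n. stirling_rem (Suc n) - 1 / (2 * real (Suc n)))"
    unfolding incseq_Suc_iff by (intro allI stirling_rem_step(2)) simp
  moreover have "(\<lambda>n. stirling_rem (Suc n) - 1 / (2 * real (Suc n))) \<longlonglongrightarrow> ln (2 * pi) / 2 - 0"
  proof (intro tendsto_diff stirling_rem_LIMSEQ)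
    have "(\<lambda>n. 1/2 * (1 / real (Suc n))) \<longlonglongrightarrow> 1/2 * 0"
      by (intro tendsto_intros LIMSEQ_Suc[OF lim_1_over_n])
    then show "(\<lambda>n. 1 / (2 * real (Suc n))) \<longlonglongrightarrow> 0" by simp
  qed
  ultimately have "stirling_rem (Suc m) - 1 / (2 * real (Suc m)) \<le> ln (2 * pi) / 2 - 0"
    by (rule incseq_le)
  then show "stirling_rem n \<le> ln (2 * pi) / 2 + 1 / (2 * real n)" by (simp add: m)
qed


text \<open>\<open>ell x = ln (2 * sinh (x / 2) / x)\<close>: subtracting \<open>ln x\<close> removes the singularity of
  \<open>ln (1 - exp (- x))\<close> at \<open>0\<close> and leaves a factorial, to which Stirling's formula applies.\<close>

definition ell :: "real \<Rightarrow> real" where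
  "ell x = ln (1 - exp (- x)) + x / 2 - ln x"

text \<open>The antiderivative of \<open>ell\<close> that is continuous at 0, with value
  \<open>dilog 1\<close> = pi^2 / 6 there.\<close>

definition ell_prim :: "real \<Rightarrow> real" where
  "ell_prim x = dilog (exp (- x)) + x\<^sup>2 / 4 - (x * ln x - x)"

definition ell_deriv :: "real \<Rightarrow> real" where
  "ell_deriv x = 1 / (exp x - 1) + 1/2 - 1 / x"

lemma ell_bounds:
  assumes "0 < x"
  shows "0 \<le> ell x" "ell x \<le> x / 2"
proof -
  have E: "1 - exp (- x) > 0" using assms by simp
  have "x * exp (- x / 2) \<le> 1 - exp (- x)"
  proof -
    have "x * exp (- x / 2) \<le> (2 * sinh (x / 2)) * exp (- x / 2)"
      using sinh_ge_self[of "x/2"] assms by (intro mult_right_mono) auto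
    also have "\<dots> = exp (x / 2) * exp (- x / 2) - exp (- (x / 2)) * exp (- x / 2)"
      by (simp add: sinh_def left_diff_distrib)
    also have "\<dots> = 1 - exp (- x)"
      by (simp flip: exp_add)
    finally show ?thesis .
  qed
  then have "ln (x * exp (- x / 2)) \<le> ln (1 - exp (- x))"
    using assms E by simp
  then show "0 \<le> ell x"
    using assms by (simp add: ell_def ln_mult)
  have "1 - exp (- x) \<le> x" using exp_ge_add_one_self[of "-x"] by simp
  then have "ln (1 - exp (- x)) \<le> ln x" using assms E by simp
  then show "ell x \<le> x / 2" by (simp add: ell_def)
qed

lemma DERIV_ell_prim: "0 < x \<Longrightarrow> (ell_prim has_real_derivative ell x) (at x)"
  unfolding ell_prim_def[abs_def] ell_def
  by (auto intro!: derivative_eq_intros DERIV_dilog_exp)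

lemma DERIV_ell:
  assumes "0 < x"
  shows "(ell has_real_derivative ell_deriv x) (at x)"
proof -
  have "(ell has_real_derivative exp (- x) / (1 - exp (- x)) + 1/2 - 1 / x) (at x)"
    unfolding ell_def[abs_def] using assms by (auto intro!: derivative_eq_intros)
  moreover have "exp (- x) / (1 - exp (- x)) = 1 / (exp x - 1)"
    using assms by (simp add: exp_minus field_simps)
  ultimately show ?thesis by (simp add: ell_deriv_def)
qed

text \<open>The second derivative of \<open>ell\<close> is (1 - bose2 z) / z^2, so convexity is the
  bound \<open>bose2\<close> <= 1.\<close>

lemma ell_deriv_mono:
  assumes "0 < x" "x \<le> y"
  shows "ell_deriv x \<le> ell_deriv y"
proof (rule DERIV_nonneg_imp_nondecreasing[OF assms(2)])
  fix z :: real assume "x \<le> z" "z \<le> y"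
  then have z: "0 < z" using assms by simp
  have "(ell_deriv has_real_derivative - (exp z / (exp z - 1)\<^sup>2) + 1 / z\<^sup>2) (at z)"
    unfolding ell_deriv_def[abs_def] using z
    by (auto intro!: derivative_eq_intros simp: power2_eq_square)
  moreover have "bose2 z \<le> 1"
    using bose2_antimono[of 0 z] z by (simp add: bose2_def)
  then have "exp z / (exp z - 1)\<^sup>2 \<le> 1 / z\<^sup>2"
    using z by (simp add: bose2_def field_simps)
  ultimately show "\<exists>d. (ell_deriv has_real_derivative d) (at z) \<and> 0 \<le> d"
    by (intro exI conjI) auto
qed

lemma ell_deriv_bounds:
  assumes "0 < x"
  shows "0 \<le> ell_deriv x" "ell_deriv x \<le> 1/2"
proof -
  have "x \<le> exp x - 1" using exp_ge_add_one_self[of x] by linarith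
  then have "1 / (exp x - 1) \<le> 1 / x" using assms by (intro divide_left_mono) auto
  then show "ell_deriv x \<le> 1/2" by (simp add: ell_deriv_def)
  have "0 * (exp 0 + 1) - 2 * (exp 0 - 1) \<le> x * (exp x + 1) - 2 * (exp x - 1)"
  proof (rule DERIV_nonneg_imp_nondecreasing[where f = "\<lambda>x::real. x * (exp x + 1) - 2 * (exp x - 1)"])
    fix y :: real
    have "((\<lambda>x. x * (exp x + 1) - 2 * (exp x - 1)) has_real_derivative 1 - (1 - y) * exp y) (at y)"
      by (auto intro!: derivative_eq_intros simp: algebra_simps)
    moreover have "(1 - y) * exp y \<le> exp (- y) * exp y"
      using exp_ge_add_one_self[of "-y"] by (intro mult_right_mono) auto
    then have "0 \<le> 1 - (1 - y) * exp y" by (simp flip: exp_add)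
    ultimately show "\<exists>d. ((\<lambda>x. x * (exp x + 1) - 2 * (exp x - 1)) has_real_derivative d) (at y) \<and> 0 \<le> d"
      by blast
  qed (use assms in auto)
  then have *: "2 * (exp x - 1) \<le> x * (exp x + 1)" by simp
  have "ell_deriv x = (x * (exp x + 1) - 2 * (exp x - 1)) / (2 * x * (exp x - 1))"
    using assms by (simp add: ell_deriv_def divide_simps) (simp add: algebra_simps)
  then show "0 \<le> ell_deriv x" using * assms by simp
qed

text \<open>Near 0, |x ln x| <= 2 sqrt x, from ln u <= u - 1 at u = 1 / sqrt x.\<close>

lemma continuous_on_mult_ln: "continuous_on {0..} (\<lambda>x::real. x * ln x)"
  unfolding continuous_on_eq_continuous_within
proof
  fix x :: real assume "x \<in> {0..}"
  then consider "x = 0" | "x > 0" by fastforce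
  then show "continuous (at x within {0..}) (\<lambda>x. x * ln x)"
  proof cases
    case 1
    have "((\<lambda>x::real. x * ln x) \<longlongrightarrow> 0) (at 0 within {0..})"
    proof (rule Lim_null_comparison)
      have "\<bar>x * ln x\<bar> \<le> 2 * sqrt x" if "0 < x" "x < 1" for x :: real
      proof -
        have "ln (1 / sqrt x) \<le> 1 / sqrt x - 1"
          using that by (intro ln_le_minus_one) auto
        moreover have "ln (1 / sqrt x) = - ln x / 2"
          using that by (simp add: ln_div ln_sqrt)
        ultimately have "- ln x \<le> 2 / sqrt x" by simp
        then have "x * - ln x \<le> x * (2 / sqrt x)"
          using that by (intro mult_left_mono) auto
        also have "\<dots> = 2 * (x / sqrt x)" by simp
        also have "x / sqrt x = sqrt x" using that by (intro real_div_sqrt) auto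
        finally show ?thesis using that ln_less_zero[of x] by (simp add: abs_mult)
      qed
      then show "\<forall>\<^sub>F x in at 0 within {0..}. norm (x * ln x) \<le> 2 * sqrt x"
        by (auto simp: eventually_at dist_real_def intro!: exI[of _ 1])
      have "((\<lambda>x. 2 * sqrt x) \<longlongrightarrow> 2 * sqrt 0) (at 0 within {0..})"
        by (intro tendsto_intros)
      then show "((\<lambda>x. 2 * sqrt x) \<longlongrightarrow> 0) (at 0 within {0..})" by simp
    qed
    with 1 show ?thesis by (simp add: continuous_within)
  qed (auto intro!: continuous_intros)
qed

text \<open>The trapezoids begin at v because the derivative facts require a positive argument. The
  interval [0, v] left out costs v \<open>ell z\<close> for some z in it, hence at most v^2 /
  2.\<close>

lemma ell_prim_start:
  assumes "0 < v"
  shows "0 \<le> ell_prim v - pi\<^sup>2 / 6" "ell_prim v - pi\<^sup>2 / 6 \<le> v * (v / 2)"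
proof -
  have "\<exists>l z. 0 < z \<and> z < v \<and> (ell_prim has_real_derivative l) (at z) \<and> ell_prim v - ell_prim 0 = (v - 0) * l"
  proof (rule MVT[OF assms])
    show "continuous_on {0..v} ell_prim"
      unfolding ell_prim_def[abs_def]
      by (rule continuous_on_subset[of "{0..}"],
          intro continuous_intros continuous_on_dilog_exp continuous_on_mult_ln) auto
    show "ell_prim differentiable (at x)" if "0 < x" for x
      using DERIV_ell_prim[OF that] by (auto simp: real_differentiable_def)
  qed
  then obtain l z where z: "0 < z" "z < v" "(ell_prim has_real_derivative l) (at z)"
    "ell_prim v - ell_prim 0 = v * l" by auto
  have l: "l = ell z" using DERIV_unique[OF z(3) DERIV_ell_prim[OF z(1)]] .
  have "ell_prim 0 = pi\<^sup>2 / 6" by (simp add: ell_prim_def dilog_one)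
  then have eq: "ell_prim v - pi\<^sup>2 / 6 = v * ell z" using z l by simp
  show "0 \<le> ell_prim v - pi\<^sup>2 / 6" unfolding eq using ell_bounds[OF z(1)] assms by simp
  show "ell_prim v - pi\<^sup>2 / 6 \<le> v * (v / 2)" unfolding eq
    using ell_bounds(2)[OF z(1)] z assms by (intro mult_left_mono) auto
qed

text \<open>The errors telescope to v^2 / 2 times an increment of \<open>ell_deriv\<close>, whose
  values lie in [0, 1/2].\<close>

lemma sum_ell_trapezoid:
  assumes v: "0 < v" and X: "1 \<le> X"
  defines "T \<equiv> v * ((\<Sum>j=1..X. ell (v * real j)) - ell v / 2 - ell (v * real X) / 2) - (ell_prim (v * real X) - ell_prim v)"
  shows "0 \<le> T" "T \<le> v\<^sup>2 / 4"
proof -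
  define U where "U X = v * ((\<Sum>j=1..X. ell (v * real j)) - ell v / 2 - ell (v * real X) / 2) - (ell_prim (v * real X) - ell_prim v)" for X
  have "0 \<le> U X \<and> U X \<le> v\<^sup>2 / 2 * (ell_deriv (v * real X) - ell_deriv v)"
    using X
  proof (induction X rule: dec_induct)
    case base
    then show ?case by (simp add: U_def)
  next
    case (step X)
    define a b where "a = v * real X" and "b = v * real (Suc X)"
    have ab: "0 < a" "a < b" "b - a = v"
      using v step by (simp_all add: a_def b_def algebra_simps)
    have tr: "0 \<le> (b - a) * (ell a + ell b) / 2 - (ell_prim b - ell_prim a)"
      "(b - a) * (ell a + ell b) / 2 - (ell_prim b - ell_prim a) \<le> (b - a)\<^sup>2 / 2 * (ell_deriv b - ell_deriv a)"
      using ab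
      by (intro trapezoid_error[where d = ell_deriv] DERIV_ell_prim DERIV_ell ell_deriv_mono; simp)+
    have "U (Suc X) = U X + ((b - a) * (ell a + ell b) / 2 - (ell_prim b - ell_prim a))"
      unfolding ab(3) by (simp add: U_def a_def b_def field_simps)
    with tr step.IH show ?case
      unfolding a_def[symmetric] b_def[symmetric] ab(3) by (auto simp: right_diff_distrib)
  qed
  moreover have "v\<^sup>2 / 2 * (ell_deriv (v * real X) - ell_deriv v) \<le> v\<^sup>2 / 2 * (1/2)"
    using ell_deriv_bounds[of v] ell_deriv_bounds[of "v * real X"] v X by (intro mult_left_mono) auto
  ultimately show "0 \<le> T" "T \<le> v\<^sup>2 / 4" by (auto simp: T_def U_def)
qed

lemma sum_ell_asymp:
  assumes v: "0 < v" and X: "1 \<le> X"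
  shows "\<bar>(\<Sum>j=1..X. ell (v * real j)) - ((ell_prim (v * real X) - pi\<^sup>2 / 6) / v + ell (v * real X) / 2)\<bar> \<le> v / 2"
proof -
  define T where "T = v * ((\<Sum>j=1..X. ell (v * real j)) - ell v / 2 - ell (v * real X) / 2) - (ell_prim (v * real X) - ell_prim v)"
  have T: "0 \<le> T" "T \<le> v\<^sup>2 / 4" unfolding T_def by (rule sum_ell_trapezoid[OF assms])+
  define P where "P = ell_prim v - pi\<^sup>2 / 6"
  have P: "0 \<le> P / v" "P / v \<le> v / 2"
    using ell_prim_start[OF v] v by (auto simp: P_def field_simps)
  have T': "0 \<le> T / v" "T / v \<le> v / 4"
    using T v by (auto simp: field_simps power2_eq_square)
  have "(\<Sum>j=1..X. ell (v * real j)) - ((ell_prim (v * real X) - pi\<^sup>2 / 6) / v + ell (v * real X) / 2)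
      = T / v - P / v + ell v / 2"
    using v by (simp add: T_def P_def field_simps)
  then show ?thesis
    using T' P ell_bounds[OF v] by linarith
qed

text \<open>Each summand is \<open>ell (v * j)\<close> - v j / 2 + ln v + ln j. The last three parts
  sum to closed forms and ln (fact X), so the error is v / 2 from \<open>ell\<close> plus 1 / (2 X)
  from Stirling's formula.\<close>

lemma sum_ln_one_minus_exp_asymp:
  assumes v: "0 < v" and X: "1 \<le> X"
  shows "\<bar>(\<Sum>j=1..X. ln (1 - exp (- (v * real j)))) -
      (ln (2 * pi / v) / 2 + (dilog (exp (- (v * real X))) - pi\<^sup>2 / 6) / v + ln (1 - exp (- (v * real X))) / 2)\<bar>
    \<le> v / 2 + 1 / (2 * real X)"
proof -
  define x where "x = v * real X"
  have x: "0 < x" using v X by (simp add: x_def)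
  have sum_j: "(\<Sum>j=1..X. real j) = real X * (real X + 1) / 2"
    by (induction X) (simp_all add: field_simps)
  have "(\<Sum>j=1..X. ln (1 - exp (- (v * real j)))) =
      (\<Sum>j=1..X. ell (v * real j) - v / 2 * real j + (ln v + ln (real j)))"
    by (rule sum.cong) (use v in \<open>auto simp: ell_def ln_mult\<close>)
  also have "\<dots> = (\<Sum>j=1..X. ell (v * real j)) - v / 2 * (\<Sum>j=1..X. real j) + (real X * ln v + (\<Sum>j=1..X. ln (real j)))"
    by (simp add: sum.distrib sum_subtractf sum_distrib_left)
  also have "(\<Sum>j=1..X. ln (real j)) = ln (fact X)"
    by (induction X) (simp_all add: ln_mult add.commute)
  finally have 1: "(\<Sum>j=1..X. ln (1 - exp (- (v * real j)))) =
      (\<Sum>j=1..X. ell (v * real j)) - v / 2 * (real X * (real X + 1) / 2) + (real X * ln v + ln (fact X))"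
    unfolding sum_j .
  have 2: "(ell_prim x - pi\<^sup>2 / 6) / v + ell x / 2 - v / 2 * (real X * (real X + 1) / 2)
        + (real X * ln v + (ln (2 * pi) / 2 + (real X * ln (real X) - real X + ln (real X) / 2)))
      = ln (2 * pi / v) / 2 + (dilog (exp (- x)) - pi\<^sup>2 / 6) / v + ln (1 - exp (- x)) / 2"
  proof -
    have lx: "ln x = ln v + ln (real X)" using v X by (simp add: x_def ln_mult)
    have lp: "ln (2 * pi / v) = ln (2 * pi) - ln v" using v by (simp add: ln_div)
    have "(ell_prim x - pi\<^sup>2 / 6) / v = (dilog (exp (- x)) - pi\<^sup>2 / 6) / v + (x\<^sup>2 / 4) / v - (x * ln x - x) / v"
      by (simp add: ell_prim_def diff_divide_distrib add_divide_distrib)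
    moreover have "(x\<^sup>2 / 4) / v = v * real X * real X / 4" "(x * ln x - x) / v = real X * ln x - real X"
      using v by (simp_all add: x_def power2_eq_square diff_divide_distrib)
    ultimately have e1: "(ell_prim x - pi\<^sup>2 / 6) / v =
        (dilog (exp (- x)) - pi\<^sup>2 / 6) / v + v * real X * real X / 4 - (real X * (ln v + ln (real X)) - real X)"
      by (simp add: lx)
    have e2: "ell x = ln (1 - exp (- x)) + v * real X / 2 - (ln v + ln (real X))"
      by (simp add: ell_def lx) (simp add: x_def)
    \<comment> \<open>After all transcendental terms are abstracted to variables, the collection of
      main terms is a polynomial identity.\<close>
    have "Q + v * y * y / 4 - (y * (a + b) - y) + (c + v * y / 2 - (a + b)) / 2 - v / 2 * (y * (y + 1) / 2)
        + (y * a + (p / 2 + (y * b - y + b / 2))) = (p - a) / 2 + Q + c / 2" for Q y a b c p :: real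
      by (simp add: field_simps)
    then show ?thesis unfolding lp e1 e2 .
  qed
  have 3: "\<bar>ln (fact X) - (ln (2 * pi) / 2 + (real X * ln (real X) - real X + ln (real X) / 2))\<bar> \<le> 1 / (2 * real X)"
    using stirling_rem_bounds[OF X] by (simp add: stirling_rem_def abs_le_iff)
  show ?thesis
    using 3 sum_ell_asymp[OF v X] unfolding 1 x_def[symmetric] 2[symmetric] by linarith
qed

section \<open>Comparison with the Gaussian\<close>

lemma exp_ln_qfact:
  assumes "0 < v"
  shows "exp (ln_qfact v X t) = qfact (of_real (exp (- v)) * cis t) X"
proof -
  have "exp (ln_qfact v X t) = (\<Prod>j=1..X. 1 - of_real (exp (- (v * real j))) * cis (real j * t))"
    unfolding ln_qfact_def exp_sum[OF finite_atLeastAtMost]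
  proof (rule prod.cong[OF refl])
    fix j assume "j \<in> {1..X}"
    then have "norm (of_real (exp (- (v * real j))) * cis (real j * t)) < 1"
      using assms by (simp add: norm_mult)
    then have "1 - of_real (exp (- (v * real j))) * cis (real j * t) \<noteq> 0"
      by (metis eq_iff_diff_eq_0 less_irrefl norm_one)
    then show "exp (Ln (1 - of_real (exp (- (v * real j))) * cis (real j * t))) =
        1 - of_real (exp (- (v * real j))) * cis (real j * t)" by simp
  qed
  also have "\<dots> = qfact (of_real (exp (- v)) * cis t) X"
    unfolding qfact_def
  proof (rule prod.cong[OF refl])
    fix j
    have "exp (- (v * real j)) = exp (- v) ^ j" by (simp add: mult_ac flip: exp_of_nat_mult)
    then show "1 - of_real (exp (- (v * real j))) * cis (real j * t) = 1 - (of_real (exp (- v)) * cis t) ^ j"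
      by (simp only: power_mult_distrib Complex.DeMoivre of_real_power)
  qed
  finally show ?thesis .
qed

lemma ln_qfact_0:
  assumes "0 < v"
  shows "ln_qfact v X 0 = of_real (\<Sum>j=1..X. ln (1 - exp (- (v * real j))))"
proof -
  have "Ln (1 - of_real (exp (- (v * real j)))) = of_real (ln (1 - exp (- (v * real j))))" if "j \<in> {1..X}" for j
  proof -
    have "0 < 1 - exp (- (v * real j))" using that assms by simp
    from Ln_of_real[OF this] show ?thesis by simp
  qed
  then show ?thesis by (simp add: ln_qfact_def)
qed

lemma sum_box_partitions_eq_exp:
  assumes "0 < v"
  shows "(\<Sum>P\<in>box_partitions N M. (of_real (exp (- v)) * cis t) ^ sum_mset P) =
    exp (ln_qfact v (N + M) t - ln_qfact v N t - ln_qfact v M t)"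
proof -
  have "Z = c / a / b" if "Z * (a * b) = c" "a \<noteq> 0" "b \<noteq> 0" for Z a b c :: complex
    using that by (simp add: field_simps)
  then show ?thesis
    using sum_box_partitions_qfact[of "of_real (exp (- v)) * cis t" N M]
    unfolding exp_ln_qfact[OF assms, symmetric] exp_diff by (metis exp_not_eq_zero)
qed

text \<open>Along the segment the real part is a convex combination of the end values, so the
  derivative stays below the common bound m.\<close>

lemma norm_exp_diff_le:
  fixes a b :: complex
  assumes "exp (Re a) \<le> m" "exp (Re b) \<le> m"
  shows "norm (exp a - exp b) \<le> m * norm (a - b)"
proof (rule field_differentiable_bound[of "closed_segment a b"])
  fix z assume "z \<in> closed_segment a b"
  then obtain u where u: "z = (1 - u) *\<^sub>R a + u *\<^sub>R b" "0 \<le> u" "u \<le> 1"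
    by (auto simp: in_segment)
  have "Re z \<le> max (Re a) (Re b)"
  proof -
    have "Re z = (1 - u) * Re a + u * Re b" using u by simp
    also have "\<dots> \<le> (1 - u) * max (Re a) (Re b) + u * max (Re a) (Re b)"
      using u by (intro add_mono mult_left_mono) auto
    finally show ?thesis by (simp add: algebra_simps)
  qed
  then have "exp (Re z) \<le> exp (max (Re a) (Re b))" by simp
  also have "\<dots> \<le> m" using assms by (simp add: max_def)
  finally show "norm (exp z) \<le> m" by simp
qed (auto intro!: derivative_eq_intros)

lemma has_integral_gaussian:
  fixes a :: real
  assumes "0 < a"
  shows "((\<lambda>t. exp (- (a * t\<^sup>2))) has_integral sqrt (pi / a)) UNIV"
proof -
  define \<sigma> where "\<sigma> = 1 / sqrt (2 * a)"
  have \<sigma>: "0 < \<sigma>" "\<sigma>\<^sup>2 = 1 / (2 * a)" using assms by (auto simp: \<sigma>_def power_divide)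
  have "integrable lborel (normal_density 0 \<sigma>)"
    using \<sigma> by simp
  then have "(normal_density 0 \<sigma> has_integral 1) UNIV"
    using has_integral_integral_lborel[of "normal_density 0 \<sigma>"] \<sigma> by simp
  from has_integral_mult_right[OF this, of "sqrt (pi / a)"]
  have "((\<lambda>t. sqrt (pi / a) * normal_density 0 \<sigma> t) has_integral sqrt (pi / a)) UNIV" by simp
  moreover have "sqrt (pi / a) * normal_density 0 \<sigma> t = exp (- (a * t\<^sup>2))" for t
  proof -
    have "2 * pi * \<sigma>\<^sup>2 = pi / a" "t\<^sup>2 / (2 * \<sigma>\<^sup>2) = a * t\<^sup>2" using \<sigma> assms by simp_all
    then show ?thesis using assms by (simp add: normal_density_def)
  qed
  ultimately show ?thesis by simp
qed

text \<open>The constant 648 * 2 * 80^2 makes the quartic term of the right side equal to 648 y^4,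
  which is what 2 y^3 <= y^2 + y^4 asks for. The lower terms fit easily.\<close>

lemma cubic_le_exp:
  fixes y :: real
  assumes "0 \<le> y"
  shows "3 * y + 3/2 * y\<^sup>2 + 1296 * y ^ 3 \<le> 8294400 * exp (y\<^sup>2 / 80)"
proof -
  have "1 + y\<^sup>2 / 80 + (y\<^sup>2 / 80)\<^sup>2 / 2 \<le> exp (y\<^sup>2 / 80)"
    by (rule exp_lower_Taylor_quadratic) simp
  then have "8294400 * (1 + y\<^sup>2 / 80 + (y\<^sup>2 / 80)\<^sup>2 / 2) \<le> 8294400 * exp (y\<^sup>2 / 80)"
    by (intro mult_left_mono) auto
  moreover have "8294400 * (1 + y\<^sup>2 / 80 + (y\<^sup>2 / 80)\<^sup>2 / 2) = 8294400 + 103680 * y\<^sup>2 + 648 * (y\<^sup>2)\<^sup>2"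
    by (simp add: power_divide)
  moreover have "2 * y \<le> 1 + y\<^sup>2"
    using zero_le_power2[of "y - 1"] by (simp add: power2_eq_square algebra_simps)
  moreover have "2 * y ^ 3 \<le> y\<^sup>2 + (y\<^sup>2)\<^sup>2"
  proof -
    have "0 \<le> (y * (y - 1))\<^sup>2" by simp
    then show ?thesis by (simp add: power2_eq_square power3_eq_cube algebra_simps)
  qed
  ultimately show ?thesis using zero_le_power2[of y] by linarith
qed

lemma exp_minus_le_power6:
  fixes x :: real
  assumes "0 < x"
  shows "exp (- x) \<le> 720 / x ^ 6"
proof -
  have "x ^ 6 /\<^sub>R fact 6 \<le> exp x"
    unfolding exp_def
    using sum_le_suminf[OF summable_exp_generic[of x], of "{6}"] assms by simp
  moreover have "(fact 6 :: real) = 720" by (simp add: fact_numeral)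
  ultimately have "x ^ 6 / 720 \<le> exp x" by simp
  then show ?thesis using assms by (simp add: exp_minus field_simps)
qed


definition ln_qbinomial :: "real \<Rightarrow> nat \<Rightarrow> nat \<Rightarrow> real \<Rightarrow> complex" where
  "ln_qbinomial v N M t = ln_qfact v (N + M) t - ln_qfact v N t - ln_qfact v M t"

text \<open>The hypothesis on n is the saddle equation in the scaling v = g / sqrt n. It makes the
  linear main terms cancel i n t exactly, leaving three times the remainder of one
  q-factorial.\<close>

lemma ln_qbinomial_expansion:
  fixes v t :: real and n N M :: nat
  assumes v: "0 < v"
    and n: "real n * v\<^sup>2 = debye (v * real N) + debye (v * real M) - debye (v * real (N + M))"
  defines "L \<equiv> debye2 (v * real N) + debye2 (v * real M) - debye2 (v * real (N + M))"
  shows "norm ((ln_qbinomial v N M t - ln_qbinomial v N M 0 - \<i> * of_real (real n * t)) - of_real (- (L / (2 * v ^ 3) * t\<^sup>2)))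
    \<le> 3 * (\<bar>t\<bar> / v) + 3/2 * (t\<^sup>2 / v\<^sup>2) + 1296 * (\<bar>t\<bar> ^ 3 / v ^ 4)"
proof -
  define R where "R X = ln_qfact v X t - ln_qfact v X 0 + \<i> * of_real (t * (debye (v * real X) / v\<^sup>2))
      - of_real (t\<^sup>2 / 2 * (debye2 (v * real X) / v ^ 3))" for X
  define B where "B = \<bar>t\<bar> / v + t\<^sup>2 / (2 * v\<^sup>2) + 432 * \<bar>t\<bar> ^ 3 / v ^ 4"
  have R: "norm (R X) \<le> B" for X
    unfolding R_def B_def by (rule ln_qfact_expansion[OF v])
  have "real n = debye (v * real N) / v\<^sup>2 + debye (v * real M) / v\<^sup>2 - debye (v * real (N + M)) / v\<^sup>2"
    unfolding diff_divide_distrib[symmetric] add_divide_distrib[symmetric] n[symmetric] using v by simp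
  then have e1: "\<i> * of_real (real n * t) = \<i> * of_real (t * (debye (v * real N) / v\<^sup>2))
      + \<i> * of_real (t * (debye (v * real M) / v\<^sup>2)) - \<i> * of_real (t * (debye (v * real (N + M)) / v\<^sup>2))"
    by (simp only: of_real_add of_real_diff of_real_mult) (simp add: algebra_simps)
  have "L / (2 * v ^ 3) * t\<^sup>2 = t\<^sup>2 / 2 * (debye2 (v * real N) / v ^ 3)
      + t\<^sup>2 / 2 * (debye2 (v * real M) / v ^ 3) - t\<^sup>2 / 2 * (debye2 (v * real (N + M)) / v ^ 3)"
    unfolding L_def using v by (simp add: field_simps)
  then have e2: "complex_of_real (- (L / (2 * v ^ 3) * t\<^sup>2)) = - (of_real (t\<^sup>2 / 2 * (debye2 (v * real N) / v ^ 3))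
      + of_real (t\<^sup>2 / 2 * (debye2 (v * real M) / v ^ 3)) - of_real (t\<^sup>2 / 2 * (debye2 (v * real (N + M)) / v ^ 3)))"
    by (simp only: of_real_add of_real_diff of_real_minus)
  have "(ln_qbinomial v N M t - ln_qbinomial v N M 0 - \<i> * of_real (real n * t)) - of_real (- (L / (2 * v ^ 3) * t\<^sup>2))
      = R (N + M) - R N - R M"
    unfolding e1 e2 ln_qbinomial_def R_def by simp
  also have "norm \<dots> \<le> norm (R (N + M)) + norm (R N) + norm (R M)"
    using norm_triangle_ineq4[of "R (N + M) - R N" "R M"] norm_triangle_ineq4[of "R (N + M)" "R N"] by linarith
  also have "\<dots> \<le> 3 * B" using R[of "N + M"] R[of N] R[of M] by linarith
  also have "3 * B = 3 * (\<bar>t\<bar> / v) + 3/2 * (t\<^sup>2 / v\<^sup>2) + 1296 * (\<bar>t\<bar> ^ 3 / v ^ 4)"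
    by (simp add: B_def)
  finally show ?thesis .
qed

text \<open>The remainder P is multiplied by both parts of the decay bound. Against
  \<open>m1\<close>, half of the Gaussian exponent absorbs the polynomial and half is kept for
  integration over t. Against \<open>m2\<close>, which beats every power of v, a crude bound for P
  suffices.\<close>

lemma gaussian_approx_pointwise:
  fixes v t L :: real and n N M :: nat
  assumes v: "0 < v" "v \<le> 1/50" and N: "4 \<le> v * real N" and M: "4 \<le> v * real M"
    and n: "real n * v\<^sup>2 = debye (v * real N) + debye (v * real M) - debye (v * real (N + M))"
    and L: "L = debye2 (v * real N) + debye2 (v * real M) - debye2 (v * real (N + M))" "2/7 \<le> L"
    and t: "\<bar>t\<bar> \<le> pi"
  shows "norm (exp (ln_qbinomial v N M t - ln_qbinomial v N M 0 - \<i> * of_real (real n * t)) - of_real (exp (- (L / (2 * v ^ 3) * t\<^sup>2))))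
    \<le> 8294400 * sqrt v * exp (- (1 / (80 * v ^ 3) * t\<^sup>2)) + 933525000000 * v\<^sup>2"
proof -
  define a b where "a = ln_qbinomial v N M t - ln_qbinomial v N M 0 - \<i> * of_real (real n * t)"
    and "b = complex_of_real (- (L / (2 * v ^ 3) * t\<^sup>2))"
  define m1 m2 where "m1 = exp (- (t\<^sup>2 / (40 * v ^ 3)))" and "m2 = exp (- (1 / (5 * v)))"
  define P where "P = 3 * (\<bar>t\<bar> / v) + 3/2 * (t\<^sup>2 / v\<^sup>2) + 1296 * (\<bar>t\<bar> ^ 3 / v ^ 4)"
  have P0: "0 \<le> P" using v by (simp add: P_def)
  have ab: "norm (a - b) \<le> P"
    unfolding a_def b_def P_def L(1) by (rule ln_qbinomial_expansion[OF v(1) n])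
  have ma: "exp (Re a) \<le> m1 + m2"
    using ln_qfact_char_decay[OF v N M t] by (simp add: a_def ln_qbinomial_def m1_def m2_def)
  have mb: "exp (Re b) \<le> m1 + m2"
  proof -
    \<comment> \<open>L / 2 >= 1/7 > 1/40, so the limiting Gaussian obeys the same decay
      bound.\<close>
    have "t\<^sup>2 / (40 * v ^ 3) \<le> L / (2 * v ^ 3) * t\<^sup>2"
    proof -
      have "1/40 * (t\<^sup>2 / v ^ 3) \<le> L / 2 * (t\<^sup>2 / v ^ 3)"
        using L v by (intro mult_right_mono) auto
      then show ?thesis by simp
    qed
    then have "exp (Re b) \<le> m1" by (simp add: b_def m1_def)
    then show ?thesis by (simp add: m2_def add_increasing2)
  qed
  have "norm (exp a - exp b) \<le> (m1 + m2) * norm (a - b)"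
    by (rule norm_exp_diff_le[OF ma mb])
  also have "\<dots> \<le> (m1 + m2) * P"
    using ab by (intro mult_left_mono) (auto simp: m1_def m2_def)
  also have "\<dots> = m1 * P + m2 * P" by (simp add: distrib_right)
  also have "m1 * P \<le> 8294400 * sqrt v * exp (- (1 / (80 * v ^ 3) * t\<^sup>2))"
  proof -
    \<comment> \<open>In units of v^(3/2) the terms of P carry sqrt v, v and sqrt v, and
      \<open>m1\<close> becomes exp (- y^2 / 40).\<close>
    define y where "y = \<bar>t\<bar> / (v * sqrt v)"
    have y: "0 \<le> y" using v by (simp add: y_def)
    have sv: "0 < sqrt v" "sqrt v * sqrt v = v" using v by auto
    have y1: "\<bar>t\<bar> = y * (v * sqrt v)" using v by (simp add: y_def)
    have y2: "t\<^sup>2 = y\<^sup>2 * v ^ 3"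
    proof -
      have "t\<^sup>2 = \<bar>t\<bar>\<^sup>2" by simp
      also have "\<dots> = y\<^sup>2 * (v\<^sup>2 * (sqrt v * sqrt v))" unfolding y1 by (simp add: power2_eq_square)
      finally show ?thesis unfolding sv by (simp add: power2_eq_square power3_eq_cube)
    qed
    have y3: "\<bar>t\<bar> ^ 3 = y ^ 3 * (v ^ 4 * sqrt v)"
    proof -
      have "\<bar>t\<bar> ^ 3 = y ^ 3 * (v ^ 3 * (sqrt v * sqrt v) * sqrt v)" unfolding y1 by (simp add: power3_eq_cube)
      then show ?thesis unfolding sv by (simp add: power3_eq_cube power4_eq_xxxx)
    qed
    have "v \<le> sqrt v" using v by (intro real_le_rsqrt) (simp add: power2_eq_square mult_left_le)
    then have "y\<^sup>2 * v \<le> y\<^sup>2 * sqrt v" by (intro mult_left_mono) auto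
    moreover have "P = 3 * (y * sqrt v) + 3/2 * (y\<^sup>2 * v) + 1296 * (y ^ 3 * sqrt v)"
      unfolding P_def y1 y2 y3[unfolded y1] using v
      by (simp add: power2_eq_square power3_eq_cube power4_eq_xxxx)
    ultimately have "P \<le> 3 * (y * sqrt v) + 3/2 * (y\<^sup>2 * sqrt v) + 1296 * (y ^ 3 * sqrt v)" by linarith
    also have "\<dots> = (3 * y + 3/2 * y\<^sup>2 + 1296 * y ^ 3) * sqrt v" by (simp add: algebra_simps)
    also have "\<dots> \<le> (8294400 * exp (y\<^sup>2 / 80)) * sqrt v"
      using cubic_le_exp[OF y] sv by (intro mult_right_mono) auto
    finally have m1P: "m1 * P \<le> m1 * ((8294400 * exp (y\<^sup>2 / 80)) * sqrt v)"
      by (intro mult_left_mono) (auto simp: m1_def)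
    have "m1 * exp (y\<^sup>2 / 80) = exp (- (1 / (80 * v ^ 3) * t\<^sup>2))"
      using v by (simp add: m1_def y2 flip: exp_add)
    moreover have "m1 * ((8294400 * exp (y\<^sup>2 / 80)) * sqrt v) = 8294400 * sqrt v * (m1 * exp (y\<^sup>2 / 80))"
      by simp
    ultimately show ?thesis using m1P by (simp only:)
  qed
  also have "m2 * P \<le> 933525000000 * v\<^sup>2"
  proof -
    have t4: "\<bar>t\<bar> \<le> 4" using t pi_less_4 by linarith
    have "P \<le> 82980 / v ^ 4"
    proof -
      have vv: "v ^ 4 \<le> v" "v ^ 4 \<le> v\<^sup>2"
        using v power_decreasing[of 1 4 v] power_decreasing[of 2 4 v] by auto
      have "\<bar>t\<bar> / v \<le> 4 / v ^ 4" using t4 v vv by (intro frac_le) auto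
      moreover have "t\<^sup>2 \<le> 4\<^sup>2" using t4 abs_le_square_iff[of t 4] by simp
      then have "t\<^sup>2 / v\<^sup>2 \<le> 16 / v ^ 4" using v vv by (intro frac_le) auto
      moreover have "\<bar>t\<bar> ^ 3 \<le> 4 ^ 3" using t4 by (intro power_mono) auto
      then have "\<bar>t\<bar> ^ 3 / v ^ 4 \<le> 64 / v ^ 4" using v by (intro divide_right_mono) auto
      ultimately have "P \<le> 3 * (4 / v ^ 4) + 3/2 * (16 / v ^ 4) + 1296 * (64 / v ^ 4)"
        unfolding P_def by (intro add_mono mult_left_mono) auto
      also have "\<dots> = 82980 / v ^ 4" by simp
      finally show ?thesis .
    qed
    moreover have "m2 \<le> 11250000 * v ^ 6"
    proof -
      have "m2 \<le> 720 / (1 / (5 * v)) ^ 6"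
        unfolding m2_def using v by (intro exp_minus_le_power6) auto
      also have "\<dots> = 11250000 * v ^ 6" by (simp add: power_divide power_mult_distrib)
      finally show ?thesis .
    qed
    ultimately have "m2 * P \<le> (11250000 * v ^ 6) * (82980 / v ^ 4)"
      using P0 v by (intro mult_mono) auto
    also have "\<dots> = 933525000000 * v\<^sup>2"
      using v by (simp add: eval_nat_numeral)
    finally show ?thesis .
  qed
  finally show ?thesis
    by (simp add: a_def b_def flip: exp_of_real)
qed


text \<open>The Cauchy integrand is divided by its value at t = 0, so that it can be compared
  directly with a Gaussian of height 1.\<close>

lemma has_integral_ln_qbinomial:
  fixes v :: real and n N M :: nat
  assumes v: "0 < v"
  defines "a \<equiv> (\<Sum>j=1..N + M. ln (1 - exp (- (v * real j)))) - (\<Sum>j=1..N. ln (1 - exp (- (v * real j))))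
      - (\<Sum>j=1..M. ln (1 - exp (- (v * real j))))"
  shows "((\<lambda>t. exp (ln_qbinomial v N M t - ln_qbinomial v N M 0 - \<i> * of_real (real n * t)))
    has_integral of_real (2 * pi * real (partition_count n N M) * exp (- (real n * v + a)))) {-pi..pi}"
proof -
  have a: "ln_qbinomial v N M 0 = of_real a"
    unfolding ln_qbinomial_def ln_qfact_0[OF v] a_def by simp
  have eq1: "exp (ln_qbinomial v N M t - ln_qbinomial v N M 0 - \<i> * of_real (real n * t)) =
      of_real (exp (- a)) * ((\<Sum>P\<in>box_partitions N M. (of_real (exp (- v)) * cis t) ^ sum_mset P) * cis (- (real n * t)))" for t
  proof -
    have "cis (- (real n * t)) = exp (- (\<i> * of_real (real n * t)))" by (simp add: cis_conv_exp)
    moreover have "complex_of_real (exp (- a)) = exp (- of_real a)" by (simp add: exp_of_real[symmetric])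
    ultimately show ?thesis
      unfolding sum_box_partitions_eq_exp[OF v] ln_qbinomial_def[symmetric] a
      by (simp only: exp_add[symmetric]) (simp add: algebra_simps)
  qed
  have eq2: "of_real (exp (- a)) * complex_of_real (2 * pi * (real (partition_count n N M) * exp (- v) ^ n)) =
      of_real (2 * pi * real (partition_count n N M) * exp (- (real n * v + a)))"
  proof -
    have "exp (- v) ^ n = exp (- (real n * v))" by (simp flip: exp_of_nat_mult)
    moreover have "exp (- (real n * v + a)) = exp (- (real n * v)) * exp (- a)" by (simp flip: exp_add)
    ultimately have "exp (- a) * (2 * pi * (real (partition_count n N M) * exp (- v) ^ n)) =
      2 * pi * real (partition_count n N M) * exp (- (real n * v + a))" by simp
    then show ?thesis by (simp only: of_real_mult[symmetric])
  qed
  show ?thesis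
    using has_integral_mult_right[OF has_integral_partition_count[where r = "exp (- v)" and N = N and M = M and n = n],
        of "of_real (exp (- a))"] unfolding eq1 eq2 .
qed

text \<open>The integrand is extended by 0 to the whole line, which allows the exact Gaussian
  integral. One integrable majorant \<open>b\<close> serves inside and outside [-pi, pi]; its
  Gaussian part contributes sqrt v * v^(3/2) up to a constant, its constant part v^2.\<close>

lemma integral_gaussian_approx:
  fixes v L :: real and n N M :: nat
  assumes v: "0 < v" "v \<le> 1/50" and N: "4 \<le> v * real N" and M: "4 \<le> v * real M"
    and n: "real n * v\<^sup>2 = debye (v * real N) + debye (v * real M) - debye (v * real (N + M))"
    and L: "L = debye2 (v * real N) + debye2 (v * real M) - debye2 (v * real (N + M))" "2/7 \<le> L"
    and I: "((\<lambda>t. exp (ln_qbinomial v N M t - ln_qbinomial v N M 0 - \<i> * of_real (real n * t))) has_integral of_real I) {-pi..pi}"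
  shows "\<bar>I - sqrt (2 * pi * v ^ 3 / L)\<bar> \<le> 10 ^ 13 * v\<^sup>2"
proof -
  define f where "f t = exp (ln_qbinomial v N M t - ln_qbinomial v N M 0 - \<i> * of_real (real n * t))" for t
  define \<gamma> where "\<gamma> t = exp (- (L / (2 * v ^ 3) * t\<^sup>2))" for t
  define b where "b t = 8294400 * sqrt v * exp (- (1 / (80 * v ^ 3) * t\<^sup>2)) +
      (if t \<in> {-pi..pi} then 933525000000 * v\<^sup>2 else 0)" for t
  have f: "((\<lambda>t. if t \<in> {-pi..pi} then f t else 0) has_integral of_real I) UNIV"
    using I unfolding f_def[symmetric] by (simp only: has_integral_restrict_UNIV)
  have "(\<gamma> has_integral sqrt (pi / (L / (2 * v ^ 3)))) UNIV"
    unfolding \<gamma>_def using L v by (intro has_integral_gaussian) auto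
  then have g: "((\<lambda>t. complex_of_real (\<gamma> t)) has_integral of_real (sqrt (2 * pi * v ^ 3 / L))) UNIV"
    using has_integral_of_real by (simp add: mult_ac)
  define B where "B = 8294400 * sqrt v * sqrt (pi / (1 / (80 * v ^ 3))) + 2 * pi * (933525000000 * v\<^sup>2)"
  have "((\<lambda>t. if t \<in> {-pi..pi} then 933525000000 * v\<^sup>2 else 0) has_integral 2 * pi * (933525000000 * v\<^sup>2)) UNIV"
    using has_integral_const_real[of "933525000000 * v\<^sup>2" "-pi" pi] by (simp only: has_integral_restrict_UNIV) simp
  then have b: "(b has_integral B) UNIV"
    unfolding b_def B_def using v
    by (intro has_integral_add has_integral_mult_right has_integral_gaussian) auto
  have pw: "norm ((if t \<in> {-pi..pi} then f t else 0) - complex_of_real (\<gamma> t)) \<le> b t" for t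
  proof (cases "t \<in> {-pi..pi}")
    case True
    then have "\<bar>t\<bar> \<le> pi" by auto
    with True show ?thesis
      unfolding f_def \<gamma>_def b_def
      using gaussian_approx_pointwise[OF v N M n L] by simp
  next
    case False
    then have "pi < \<bar>t\<bar>" by auto
    then have "1 \<le> \<bar>t\<bar>" using pi_gt3 by linarith
    then have t1: "1 \<le> t\<^sup>2" using abs_le_square_iff[of 1 t] by simp
    define z where "z = t\<^sup>2 / v ^ 3"
    have z: "1 / v ^ 3 \<le> z" unfolding z_def using t1 v by (intro divide_right_mono) auto
    have "0 < 1 / v ^ 3" using v by simp
    then have z0: "0 < z" using z by linarith
    have "\<gamma> t = exp (- (L / 2 * z))" by (simp add: \<gamma>_def z_def)
    \<comment> \<open>Since L / 2 >= 1/7 > 1/8 + 1/80, one part of the exponent supplies the factor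
      sqrt v and the other matches the Gaussian in \<open>b\<close>.\<close>
    also have "\<dots> \<le> exp (- (z / 8) + - (z / 80))"
    proof -
      have "1/7 * z \<le> L / 2 * z" using L z0 by (intro mult_right_mono) auto
      then have "- (L / 2 * z) \<le> - (z / 8) + - (z / 80)" using z0 by linarith
      then show ?thesis by simp
    qed
    also have "\<dots> = exp (- (z / 8)) * exp (- (z / 80))" by (rule exp_add)
    also have "exp (- (z / 8)) \<le> 8294400 * sqrt v"
    proof -
      have "exp (- (z / 8)) = 1 / exp (z / 8)" by (simp add: exp_minus field_simps)
      also have "\<dots> \<le> 1 / (z / 8)"
        using exp_ge_add_one_self[of "z/8"] z0 by (intro divide_left_mono) (auto simp del: exp_ge_add_one_self)
      also have "\<dots> \<le> 1 / (1 / v ^ 3 / 8)"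
        using z z0 v by (intro divide_left_mono divide_right_mono) auto
      also have "\<dots> = 8 * v ^ 3" by simp
      also have "v ^ 3 \<le> v" using v power_decreasing[of 1 3 v] by simp
      also have "v \<le> sqrt v" using v by (intro real_le_rsqrt) (simp add: power2_eq_square mult_left_le)
      finally have "exp (- (z / 8)) \<le> 8 * sqrt v" by simp
      also have "\<dots> \<le> 8294400 * sqrt v" using v by (intro mult_right_mono) auto
      finally show ?thesis .
    qed
    finally have "\<gamma> t \<le> 8294400 * sqrt v * exp (- (z / 80))" by simp
    moreover have "z / 80 = 1 / (80 * v ^ 3) * t\<^sup>2" by (simp add: z_def)
    moreover have "0 < \<gamma> t" by (simp add: \<gamma>_def)
    ultimately show ?thesis using False by (simp add: b_def del: atLeastAtMost_iff)
  qed
  have "norm (complex_of_real I - of_real (sqrt (2 * pi * v ^ 3 / L))) \<le> B"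
    using has_integral_norm_bound_integral_component[OF has_integral_diff[OF f g] b, of 1] pw by simp
  then have "\<bar>I - sqrt (2 * pi * v ^ 3 / L)\<bar> \<le> B"
    by (simp only: of_real_diff[symmetric] norm_of_real)
  also have "B \<le> 10 ^ 13 * v\<^sup>2"
  proof -
    have "sqrt v * sqrt (pi / (1 / (80 * v ^ 3))) = sqrt (80 * pi) * v\<^sup>2"
    proof -
      have "sqrt v * sqrt (pi / (1 / (80 * v ^ 3))) = sqrt (80 * pi * (v\<^sup>2)\<^sup>2)"
        unfolding real_sqrt_mult[symmetric]
        by (rule arg_cong[where f = sqrt]) (simp add: eval_nat_numeral)
      then show ?thesis unfolding real_sqrt_mult[of "80 * pi"] real_sqrt_abs by simp
    qed
    moreover have "sqrt (80 * pi) \<le> 16"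
      using pi_less_3_2 by (intro real_le_lsqrt) auto
    then have "sqrt (80 * pi) * v\<^sup>2 \<le> 16 * v\<^sup>2" by (intro mult_right_mono) auto
    moreover have "pi * v\<^sup>2 \<le> 4 * v\<^sup>2" using pi_less_4 by (intro mult_right_mono) auto
    moreover have "B = 8294400 * (sqrt v * sqrt (pi / (1 / (80 * v ^ 3)))) + 1867050000000 * (pi * v\<^sup>2)"
      by (simp add: B_def)
    ultimately have "B \<le> 8294400 * (16 * v\<^sup>2) + 1867050000000 * (4 * v\<^sup>2)" by linarith
    also have "\<dots> \<le> 10 ^ 13 * v\<^sup>2" by simp
    finally show ?thesis .
  qed
  finally show ?thesis .
qed

text \<open>Two independent errors meet: \<delta> in the exponent, from the value at t = 0, and
  \<eta>, the relative error of the integral. The Gaussian integral and the factor sqrt (v / (2 pi))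
  from the q-factorials combine to v^2 / sqrt L.\<close>

lemma partition_count_asymp:
  fixes v L :: real and n N M :: nat
  assumes v: "0 < v" "v \<le> 1/50" and N: "4 \<le> v * real N" and M: "4 \<le> v * real M"
    and n: "real n * v\<^sup>2 = debye (v * real N) + debye (v * real M) - debye (v * real (N + M))"
    and L: "L = debye2 (v * real N) + debye2 (v * real M) - debye2 (v * real (N + M))" "2/7 \<le> L" "L \<le> 9"
  defines "W \<equiv> real n * v + (pi\<^sup>2 / 6 + dilog (exp (- (v * real (N + M)))) - dilog (exp (- (v * real N)))
      - dilog (exp (- (v * real M)))) / v"
    and "R \<equiv> (1 - exp (- (v * real (N + M)))) / ((1 - exp (- (v * real N))) * (1 - exp (- (v * real M))))"
  shows "\<bar>real (partition_count n N M) / (v\<^sup>2 / (2 * pi * sqrt L) * sqrt R * exp W) - 1\<bar> \<le> 5 * 10 ^ 13 * sqrt v"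
proof -
  define S where "S X = (\<Sum>j=1..X. ln (1 - exp (- (v * real j))))" for X
  define T where "T X = ln (2 * pi / v) / 2 + (dilog (exp (- (v * real X))) - pi\<^sup>2 / 6) / v
      + ln (1 - exp (- (v * real X))) / 2" for X
  have ST: "\<bar>S X - T X\<bar> \<le> v" if "4 \<le> v * real X" for X
  proof -
    have X: "1 \<le> X" using that by (cases X) auto
    have "\<bar>S X - T X\<bar> \<le> v / 2 + 1 / (2 * real X)"
      unfolding S_def T_def by (rule sum_ln_one_minus_exp_asymp[OF v(1) X])
    also have "1 / (2 * real X) \<le> v / 8" using that X by (simp add: field_simps)
    finally show ?thesis using v by linarith
  qed
  define a where "a = S (N + M) - S N - S M"
  define \<delta> where "\<delta> = a - (T (N + M) - T N - T M)"
  have NM: "4 \<le> v * real (N + M)" using N M by (simp add: distrib_left)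
  have \<delta>: "\<bar>\<delta>\<bar> \<le> 3 * v"
    using ST[OF NM] ST[OF N] ST[OF M] unfolding \<delta>_def a_def by linarith
  have q: "0 < 1 - exp (- (v * real X))" if "4 \<le> v * real X" for X using that by simp
  have R: "0 < R" unfolding R_def using q[OF NM] q[OF N] q[OF M] by simp
  \<comment> \<open>Of the three copies of ln (2 pi / v) / 2 and of - pi^2 / 6 the signs +, -, -
    leave one copy with reversed sign.\<close>
  have "T (N + M) - T N - T M = ln (v / (2 * pi)) / 2 + (W - real n * v) + ln R / 2"
  proof -
    have "ln R = ln (1 - exp (- (v * real (N + M)))) - ln (1 - exp (- (v * real N))) - ln (1 - exp (- (v * real M)))"
      unfolding R_def using q[OF NM] q[OF N] q[OF M] by (simp only: ln_divide_pos ln_mult_pos mult_pos_pos)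
    moreover have "ln (v / (2 * pi)) = - ln (2 * pi / v)"
      using v by (simp add: ln_div)
    ultimately show ?thesis
      by (simp add: T_def W_def diff_divide_distrib add_divide_distrib)
  qed
  then have na: "real n * v + a = W + ln (v / (2 * pi)) / 2 + ln R / 2 + \<delta>" by (simp add: \<delta>_def)
  have e: "exp (real n * v + a) = exp W * sqrt (v / (2 * pi)) * sqrt R * exp \<delta>"
  proof -
    have "exp (ln y / 2) = sqrt y" if "0 < y" for y :: real
      using that by (simp flip: ln_sqrt)
    then show ?thesis unfolding na exp_add using v R by simp
  qed
  define p where "p = real (partition_count n N M)"
  define I where "I = 2 * pi * p * exp (- (real n * v + a))"
  define G where "G = sqrt (2 * pi * v ^ 3 / L)"
  have G: "0 < G" using v L by (simp add: G_def)
  have I: "\<bar>I - G\<bar> \<le> 10 ^ 13 * v\<^sup>2"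
    unfolding G_def
    by (rule integral_gaussian_approx[OF v N M n L(1,2)])
      (use has_integral_ln_qbinomial[OF v(1), where N = N and M = M and n = n] in
        \<open>simp add: I_def p_def a_def S_def\<close>)
  \<comment> \<open>Because L <= 9, the Gaussian integral is at least of order v^(3/2); this
    converts the absolute error v^2 into the relative error sqrt v.\<close>
  have G_ge: "v\<^sup>2 \<le> 2 * sqrt v * G"
  proof -
    have "v\<^sup>2 = sqrt (v ^ 4)" by (rule real_sqrt_unique[symmetric]) (auto simp: power2_eq_square power4_eq_xxxx)
    also have "\<dots> \<le> sqrt (4 * v * (2 * pi * v ^ 3 / L))"
    proof (rule real_sqrt_le_mono)
      have "1 \<le> 8 * pi / L" using L pi_gt3 by simp
      then have "v ^ 4 * 1 \<le> v ^ 4 * (8 * pi / L)" using v by (intro mult_left_mono) auto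
      also have "\<dots> = 4 * v * (2 * pi * v ^ 3 / L)" by (simp add: power3_eq_cube power4_eq_xxxx)
      finally show "v ^ 4 \<le> 4 * v * (2 * pi * v ^ 3 / L)" by simp
    qed
    also have "\<dots> = sqrt (4 * v) * G" unfolding G_def by (rule real_sqrt_mult)
    also have "sqrt (4 * v) = 2 * sqrt v" by (simp add: real_sqrt_mult)
    finally show ?thesis .
  qed
  define \<eta> where "\<eta> = I / G - 1"
  have \<eta>: "\<bar>\<eta>\<bar> \<le> 2 * 10 ^ 13 * sqrt v"
  proof -
    have "\<bar>I - G\<bar> \<le> 2 * 10 ^ 13 * sqrt v * G"
      using order_trans[OF I mult_left_mono[OF G_ge, of "10 ^ 13"]] by (simp add: mult_ac)
    moreover have "\<eta> = (I - G) / G" using G by (simp add: \<eta>_def diff_divide_distrib)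
    ultimately show ?thesis using G by (simp add: abs_divide pos_divide_le_eq)
  qed
  have "p = I / (2 * pi) * exp (real n * v + a)"
  proof -
    have "exp (- (real n * v + a)) * exp (real n * v + a) = 1" by (simp flip: exp_add)
    then show ?thesis by (simp add: I_def)
  qed
  also have "I = G * (1 + \<eta>)" using G by (simp add: \<eta>_def)
  finally have p: "p = G * sqrt (v / (2 * pi)) / (2 * pi) * sqrt R * exp W * (exp \<delta> * (1 + \<eta>))"
    unfolding e by simp
  moreover have "G * sqrt (v / (2 * pi)) = v\<^sup>2 / sqrt L"
  proof -
    have "G * sqrt (v / (2 * pi)) = sqrt ((v\<^sup>2)\<^sup>2 / L)"
      unfolding G_def real_sqrt_mult[symmetric]
      by (rule arg_cong[where f = sqrt]) (simp add: eval_nat_numeral)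
    then show ?thesis unfolding real_sqrt_divide real_sqrt_abs by simp
  qed
  ultimately have p2: "p = (v\<^sup>2 / (2 * pi * sqrt L) * sqrt R * exp W) * (exp \<delta> * (1 + \<eta>))"
    by simp
  have "v\<^sup>2 / (2 * pi * sqrt L) * sqrt R * exp W \<noteq> 0" using v L R by simp
  then have quot: "p / (v\<^sup>2 / (2 * pi * sqrt L) * sqrt R * exp W) = exp \<delta> * (1 + \<eta>)"
    unfolding p2 by simp
  have \<delta>2: "\<bar>exp \<delta> - 1\<bar> \<le> 2 * \<bar>\<delta>\<bar>"
  proof -
    have "exp \<delta> \<le> 1 + 2 * \<bar>\<delta>\<bar>"
      using exp_bound_lemma[of \<delta>] \<delta> v by simp
    moreover have "1 + \<delta> \<le> exp \<delta>" by simp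
    ultimately show ?thesis by linarith
  qed
  have "\<bar>exp \<delta> * (1 + \<eta>) - 1\<bar> = \<bar>(exp \<delta> - 1) + exp \<delta> * \<eta>\<bar>" by (simp add: algebra_simps)
  also have "\<dots> \<le> \<bar>exp \<delta> - 1\<bar> + \<bar>exp \<delta> * \<eta>\<bar>" by (rule abs_triangle_ineq)
  also have "\<bar>exp \<delta> * \<eta>\<bar> \<le> 2 * \<bar>\<eta>\<bar>"
    using \<delta>2 \<delta> v unfolding abs_mult by (intro mult_right_mono) auto
  also have "\<bar>exp \<delta> - 1\<bar> \<le> 6 * sqrt v"
  proof -
    have "v \<le> sqrt v" using v by (intro real_le_rsqrt) (simp add: power2_eq_square mult_left_le)
    then show ?thesis using \<delta>2 \<delta> by linarith
  qed
  also have "6 * sqrt v + 2 * \<bar>\<eta>\<bar> \<le> 5 * 10 ^ 13 * sqrt v"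
    using \<eta> v by simp
  finally show ?thesis unfolding quot[symmetric] p_def by simp
qed


lemma main_term_relative_error:
  fixes n N M :: nat
  assumes n: "10000 \<le> n" and N: "4 * sqrt (real n) \<le> real N" and M: "4 * sqrt (real n) \<le> real M"
  shows "main_term n N M \<noteq> 0"
    and "\<bar>real (partition_count n N M) / main_term n N M - 1\<bar> \<le> 10 ^ 14 * real n powr (- 1/4)"
proof -
  define \<alpha> \<beta> where "\<alpha> = real N / sqrt (real n)" and "\<beta> = real M / sqrt (real n)"
  define g L where "g = saddle \<alpha> \<beta>" and "L = L_fun \<alpha> \<beta>"
  define v where "v = g / sqrt (real n)"
  \<comment> \<open>With g < 2 this yields v <= 1/50, hence exp (- v) >= 49/50 as the decay estimate
    requires.\<close>
  have sn: "100 \<le> sqrt (real n)" using n by (intro real_le_rsqrt) simp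
  have \<alpha>\<beta>: "4 \<le> \<alpha>" "4 \<le> \<beta>" using N M less_le_trans[OF _ sn, of 0]
    by (simp_all add: \<alpha>_def \<beta>_def pos_le_divide_eq)
  have sad: "is_saddle \<alpha> \<beta> g" unfolding g_def by (rule is_saddle_saddle[OF \<alpha>\<beta>])
  note g = is_saddle_bounds[OF \<alpha>\<beta> sad]
  have v: "0 < v" unfolding v_def using g sn by (intro divide_pos_pos) linarith+
  have v50: "v \<le> 1/50"
  proof -
    have "v \<le> 2 / 100" unfolding v_def using g sn by (intro frac_le) auto
    then show ?thesis by simp
  qed
  have vN: "v * real N = \<alpha> * g" and vM: "v * real M = \<beta> * g"
    by (simp_all add: v_def \<alpha>_def \<beta>_def)
  then have vNM: "v * real (N + M) = (\<alpha> + \<beta>) * g" by (simp add: distrib_left distrib_right)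
  have ge: "4 \<le> c * g" if "4 \<le> c" for c
    using mult_mono[of 4 c 1 g] g that by simp
  have nv2: "real n * v\<^sup>2 = g\<^sup>2" using n by (simp add: v_def power_divide)
  have nv: "real n * v = sqrt (real n) * g"
  proof -
    have "real n * v = (real n / sqrt (real n)) * g" by (simp add: v_def)
    then show ?thesis by (simp add: real_div_sqrt)
  qed
  have n1: "real n * v\<^sup>2 = debye (v * real N) + debye (v * real M) - debye (v * real (N + M))"
    unfolding nv2 vN vM vNM using sad by (simp add: is_saddle_iff saddle_rhs_def)
  have L1: "L = debye2 (v * real N) + debye2 (v * real M) - debye2 (v * real (N + M))"
    unfolding vN vM vNM L_def g_def by (rule L_fun_eq_debye2[OF \<alpha>\<beta>])
  have L2: "2/7 \<le> L" "L \<le> 9" unfolding L_def by (rule L_fun_bounds[OF \<alpha>\<beta>])+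
  define W where "W = real n * v + (pi\<^sup>2 / 6 + dilog (exp (- (v * real (N + M)))) - dilog (exp (- (v * real N)))
      - dilog (exp (- (v * real M)))) / v"
  define R where "R = (1 - exp (- (v * real (N + M)))) / ((1 - exp (- (v * real N))) * (1 - exp (- (v * real M))))"
  have W: "sqrt (real n) * K_fun \<alpha> \<beta> = W"
  proof -
    have "1 / v = sqrt (real n) * (1 / g)" by (simp add: v_def)
    then have "y / v = sqrt (real n) * (1 / g * y)" for y
      by (metis mult.assoc mult.commute mult_1 times_divide_eq_left)
    then show ?thesis
      unfolding W_def nv vN vM vNM K_fun_def Let_def g_def[symmetric] by (simp add: distrib_left)
  qed
  have main: "main_term n N M = v\<^sup>2 / (2 * pi * sqrt L) * sqrt R * exp W"
  proof -
    have "v\<^sup>2 = g\<^sup>2 / real n" using n by (simp add: v_def power_divide)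
    then show ?thesis
      unfolding main_term_def Let_def \<alpha>_def[symmetric] \<beta>_def[symmetric] g_def[symmetric] L_def[symmetric] W
        R_def vN vM vNM by (simp add: mult_ac)
  qed
  have "0 < R" unfolding R_def vN vM vNM using ge[OF \<alpha>\<beta>(1)] ge[OF \<alpha>\<beta>(2)] ge[of "\<alpha> + \<beta>"] \<alpha>\<beta> by simp
  then show "main_term n N M \<noteq> 0" unfolding main using v L2 by simp
  have "\<bar>real (partition_count n N M) / main_term n N M - 1\<bar> \<le> 5 * 10 ^ 13 * sqrt v"
    unfolding main W_def R_def
    by (rule partition_count_asymp[OF v v50 _ _ n1 L1 L2]) (use ge \<alpha>\<beta> in \<open>simp_all add: vN vM\<close>)
  also have "sqrt v \<le> 2 * real n powr (- 1/4)"
  proof -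
    \<comment> \<open>The 4 is a round majorant of g < 2 whose square root is exact.\<close>
    have "sqrt v \<le> sqrt (4 / sqrt (real n))"
      unfolding v_def using g sn by (intro real_sqrt_le_mono divide_right_mono) auto
    also have "\<dots> = 2 * (1 / sqrt (sqrt (real n)))" by (simp add: real_sqrt_divide)
    also have "1 / sqrt (sqrt (real n)) = real n powr (- 1/4)"
      using n by (simp add: powr_half_sqrt[symmetric] powr_powr powr_minus_divide)
    finally show ?thesis .
  qed
  finally show "\<bar>real (partition_count n N M) / main_term n N M - 1\<bar> \<le> 10 ^ 14 * real n powr (- 1/4)" by simp
qed

theorem theorem1p1:
  fixes \<epsilon> :: real
  assumes "0 < \<epsilon>" and "\<epsilon> < 1/8"
  shows "(\<forall>\<alpha>\<ge>4. \<forall>\<beta>\<ge>4. \<exists>!g. is_saddle \<alpha> \<beta> g) \<and>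
    (\<exists>(C::real) (E :: nat \<Rightarrow> nat \<Rightarrow> nat \<Rightarrow> real).
      \<forall>\<^sub>F n in sequentially. \<forall>N M. real N \<ge> 4 * sqrt (real n) \<longrightarrow> real M \<ge> 4 * sqrt (real n) \<longrightarrow>
        real (partition_count n N M) = main_term n N M * (1 + E n N M) \<and>
        \<bar>E n N M\<bar> \<le> C * real n powr (- 1/4 + \<epsilon>))"
proof (intro conjI exI)
  show "\<forall>\<alpha>\<ge>4. \<forall>\<beta>\<ge>4. \<exists>!g. is_saddle \<alpha> \<beta> g"
    using ex1_saddle by blast
  \<comment> \<open>E is the exact relative error, so the equation needs only
    \<open>main_term\<close> nonzero and all content lies in the bound.\<close>
  define E where "E n N M = real (partition_count n N M) / main_term n N M - 1" for n N M
  show "\<forall>\<^sub>F n in sequentially. \<forall>N M. real N \<ge> 4 * sqrt (real n) \<longrightarrow> real M \<ge> 4 * sqrt (real n) \<longrightarrow>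
        real (partition_count n N M) = main_term n N M * (1 + E n N M) \<and>
        \<bar>E n N M\<bar> \<le> 10 ^ 14 * real n powr (- 1/4 + \<epsilon>)"
    using eventually_ge_at_top[of 10000]
  proof (eventually_elim, intro allI impI conjI)
    fix n N M :: nat
    assume *: "10000 \<le> n" "real N \<ge> 4 * sqrt (real n)" "real M \<ge> 4 * sqrt (real n)"
    show "real (partition_count n N M) = main_term n N M * (1 + E n N M)"
      using main_term_relative_error(1)[OF *] by (simp add: E_def)
    have "\<bar>E n N M\<bar> \<le> 10 ^ 14 * real n powr (- 1/4)"
      unfolding E_def by (rule main_term_relative_error(2)[OF *])
    also have "real n powr (- 1/4) \<le> real n powr (- 1/4 + \<epsilon>)"
      using * assms by (intro powr_mono) auto
    finally show "\<bar>E n N M\<bar> \<le> 10 ^ 14 * real n powr (- 1/4 + \<epsilon>)" by simp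
  qed
qed

end
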